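(* Let $\mathcal{R}$ be an expansion of $(\mathbb{R},<,+)$. If $\mathcal{R}$ is $\mathrm{NIP}$, then the open core $\mathcal{R}^\circ$ of $\mathcal{R}$ is generically locally o-minimal.
   Context: "Definable" means definable with parameters. The open core $\mathcal{R}^\circ$ is the structure on $\mathbb{R}$ whose primitive $n$-ary relations are the closures in $\mathbb{R}^n$ (usual topology) of all $\mathcal{R}$-definable subsets of $\mathbb{R}^n$. An expansion $\mathcal{S}$ of $(\mathbb{R},<)$ is generically locally o-minimal if for every $\mathcal{S}$-definable $X\subseteq\mathbb{R}$ there is a definable subset $V\subseteq X$ which is open and dense in $X$ such that for every $a\in V$ there is an open interval $I$ containing $a$ with $I\cap X$ definable in $(\mathbb{R},<)$ (i.e. a finite union of intervals and points). *)

theory Defs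
  imports "HOL-Analysis.Analysis"
begin

section \<open>First-order structures and formulas\<close>

text \<open>The universe of a structure is the whole type \<open>'a\<close>. A language may use any subsets of the
  types \<open>'f\<close> and \<open>'r\<close> as its function and relation symbols; arities and interpretations of
  elements outside these subsets, and values on lists of the wrong length, are irrelevant.\<close>

record ('f, 'r, 'a) fo_structure =
  fsyms :: "'f set"
  rsyms :: "'r set"
  farity :: "'f \<Rightarrow> nat"
  rarity :: "'r \<Rightarrow> nat"
  finterp :: "'f \<Rightarrow> 'a list \<Rightarrow> 'a"
  rinterp :: "'r \<Rightarrow> 'a list \<Rightarrow> bool"

datatype 'f fo_term = Var nat | App 'f "'f fo_term list"

datatype ('f, 'r) fo_formula =
    Equal "'f fo_term" "'f fo_term"
  | Rel 'r "'f fo_term list"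
  | Neg "('f, 'r) fo_formula"
  | Conj "('f, 'r) fo_formula" "('f, 'r) fo_formula"
  | Exists nat "('f, 'r) fo_formula"

fun wf_term :: "('f, 'r, 'a) fo_structure \<Rightarrow> 'f fo_term \<Rightarrow> bool" where
  "wf_term M (Var i) = True"
| "wf_term M (App f ts) =
     (f \<in> fsyms M \<and> length ts = farity M f \<and> (\<forall>t\<in>set ts. wf_term M t))"

fun wf_formula :: "('f, 'r, 'a) fo_structure \<Rightarrow> ('f, 'r) fo_formula \<Rightarrow> bool" where
  "wf_formula M (Equal s t) = (wf_term M s \<and> wf_term M t)"
| "wf_formula M (Rel r ts) =
     (r \<in> rsyms M \<and> length ts = rarity M r \<and> (\<forall>t\<in>set ts. wf_term M t))"
| "wf_formula M (Neg p) = wf_formula M p"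
| "wf_formula M (Conj p q) = (wf_formula M p \<and> wf_formula M q)"
| "wf_formula M (Exists i p) = wf_formula M p"

fun eval_term :: "('f, 'r, 'a) fo_structure \<Rightarrow> (nat \<Rightarrow> 'a) \<Rightarrow> 'f fo_term \<Rightarrow> 'a" where
  "eval_term M v (Var i) = v i"
| "eval_term M v (App f ts) = finterp M f (map (eval_term M v) ts)"

fun sat :: "('f, 'r, 'a) fo_structure \<Rightarrow> (nat \<Rightarrow> 'a) \<Rightarrow> ('f, 'r) fo_formula \<Rightarrow> bool" where
  "sat M v (Equal s t) = (eval_term M v s = eval_term M v t)"
| "sat M v (Rel r ts) = rinterp M r (map (eval_term M v) ts)"
| "sat M v (Neg p) = (\<not> sat M v p)"
| "sat M v (Conj p q) = (sat M v p \<and> sat M v q)"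
| "sat M v (Exists i p) = (\<exists>a. sat M (v(i := a)) p)"


section \<open>Definable sets\<close>

text \<open>Points of the \<open>n\<close>-th Cartesian power are the extensional functions on \<open>{..<n}\<close>.\<close>

abbreviation cart_power :: "nat \<Rightarrow> (nat \<Rightarrow> 'a) set" where
  "cart_power n \<equiv> {..<n} \<rightarrow>\<^sub>E (UNIV :: 'a set)"

text \<open>Definability is with parameters: the variables with index at least \<open>n\<close> (only finitely many
  of which occur in the formula) are assigned the parameters \<open>c\<close>.\<close>

definition definable :: "('f, 'r, 'a) fo_structure \<Rightarrow> nat \<Rightarrow> (nat \<Rightarrow> 'a) set \<Rightarrow> bool" where
  "definable M n X \<longleftrightarrow>
     (\<exists>p c. wf_formula M p \<and>
        X = {x \<in> cart_power n. sat M (\<lambda>i. if i < n then x i else c i) p})"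

definition definable_line :: "('f, 'r, 'a) fo_structure \<Rightarrow> 'a set \<Rightarrow> bool" where
  "definable_line M X \<longleftrightarrow> definable M 1 ((\<lambda>a. \<lambda>i\<in>{..<1}. a) ` X)"

text \<open>As usual for structures considered up to the sets they define (an open core, whose primitive
  relations are closed sets, does not literally have \<open><\<close> among its primitives), \<open>M\<close> is an expansion
  of \<open>N\<close> if every \<open>N\<close>-definable set is \<open>M\<close>-definable. In particular this covers every \<open>M\<close> whose
  language literally extends that of \<open>N\<close>.\<close>

definition expansion_of ::
  "('f, 'r, 'a) fo_structure \<Rightarrow> ('g, 's, 'a) fo_structure \<Rightarrow> bool" where
  "expansion_of M N \<longleftrightarrow> (\<forall>n X. definable N n X \<longrightarrow> definable M n X)"


section \<open>NIP\<close>

text \<open>A partitioned formula is a formula \<open>p\<close> together with a set \<open>V\<close> of variables: the object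
  variables are those in \<open>V\<close>, and all remaining free variables of \<open>p\<close> are parameter variables.
  It has the independence property if for every \<open>n\<close> there are \<open>n\<close> object tuples \<open>a 0, \<dots>\<close> and
  parameter tuples \<open>b S\<close> for \<open>S \<subseteq> {..<n}\<close> such that \<open>p(a i, b S)\<close> holds iff \<open>i \<in> S\<close>. For each \<open>n\<close>
  this is a first-order property, so it depends only on the theory of \<open>M\<close>.\<close>

definition independence_property ::
  "('f, 'r, 'a) fo_structure \<Rightarrow> nat set \<Rightarrow> ('f, 'r) fo_formula \<Rightarrow> bool" where
  "independence_property M V p \<longleftrightarrow>
     (\<forall>n. \<exists>(a :: nat \<Rightarrow> nat \<Rightarrow> 'a) (b :: nat set \<Rightarrow> nat \<Rightarrow> 'a).
        \<forall>i<n. \<forall>S\<subseteq>{..<n}. sat M (\<lambda>j. if j \<in> V then a i j else b S j) p \<longleftrightarrow> i \<in> S)"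

definition NIP :: "('f, 'r, 'a) fo_structure \<Rightarrow> bool" where
  "NIP M \<longleftrightarrow> (\<forall>p V. wf_formula M p \<longrightarrow> \<not> independence_property M V p)"


section \<open>Structures on the real line\<close>

definition real_order :: "(unit, unit, real) fo_structure" where
  "real_order = \<lparr>fsyms = {}, rsyms = UNIV, farity = (\<lambda>_. 0), rarity = (\<lambda>_. 2),
     finterp = (\<lambda>_ _. 0), rinterp = (\<lambda>_ xs. xs ! 0 < xs ! 1)\<rparr>"

definition real_ordered_group :: "(unit, unit, real) fo_structure" where
  "real_ordered_group = \<lparr>fsyms = UNIV, rsyms = UNIV, farity = (\<lambda>_. 2), rarity = (\<lambda>_. 2),
     finterp = (\<lambda>_ xs. xs ! 0 + xs ! 1), rinterp = (\<lambda>_ xs. xs ! 0 < xs ! 1)\<rparr>"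

text \<open>The relation symbols of the open core are the pairs of an arity \<open>n\<close> and the closure of a
  definable subset of the \<open>n\<close>-th power of the line; each such symbol is interpreted by its second
  component. There are no function symbols.\<close>

definition open_core ::
  "('f, 'r, real) fo_structure \<Rightarrow> (unit, nat \<times> (nat \<Rightarrow> real) set, real) fo_structure" where
  "open_core M = \<lparr>fsyms = {},
     rsyms = {(n, C). \<exists>X. definable M n X \<and> C = powertop_real {..<n} closure_of X},
     farity = (\<lambda>_. 0), rarity = fst,
     finterp = (\<lambda>_ _. 0),
     rinterp = (\<lambda>(n, C) xs. restrict (\<lambda>i. xs ! i) {..<n} \<in> C)\<rparr>"

text \<open>The notion is meant for expansions \<open>M\<close> of \<open>real_order\<close>; every open core of an expansion of
  \<open>real_order\<close> is one, see below.\<close>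

definition generically_locally_o_minimal :: "('f, 'r, real) fo_structure \<Rightarrow> bool" where
  "generically_locally_o_minimal M \<longleftrightarrow>
     (\<forall>X. definable_line M X \<longrightarrow>
        (\<exists>V. V \<subseteq> X \<and> definable_line M V \<and>
           openin (top_of_set X) V \<and> X \<subseteq> closure V \<and>
           (\<forall>a\<in>V. \<exists>I. open I \<and> is_interval I \<and> a \<in> I \<and> definable_line real_order (I \<inter> X))))"

lemma closure_strict_order:
  "powertop_real {..<2} closure_of {x \<in> cart_power 2. x 0 < x 1}
     = {x \<in> cart_power 2. x 0 \<le> x 1}" (is "?T closure_of ?A = ?B")
proof
  have "continuous_map ?T euclideanreal (\<lambda>x. x 0 - x 1)"
    by (intro continuous_map_diff continuous_map_product_projection) auto
  then have "closedin ?T {x \<in> topspace ?T. x 0 - x 1 \<in> {..0}}"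
    by (rule closedin_continuous_map_preimage) auto
  then show "?T closure_of ?A \<subseteq> ?B"
    by (intro closure_of_minimal) (auto simp: PiE_def)
  show "?B \<subseteq> ?T closure_of ?A"
  proof
    fix x :: "nat \<Rightarrow> real" assume x: "x \<in> ?B"
    define y where "y = (\<lambda>k::nat. x(0 := x 0 - 1 / real (Suc k)))"
    have "limitin ?T y x sequentially"
      unfolding limitin_componentwise
    proof (intro conjI ballI)
      fix i assume "i \<in> {..<2::nat}"
      show "limitin euclideanreal (\<lambda>k. y k i) (x i) sequentially"
      proof (cases "i = 0")
        case True
        have "(\<lambda>k. x 0 - 1 / real (Suc k)) \<longlonglongrightarrow> x 0 - 0"
          by (intro tendsto_diff tendsto_const LIMSEQ_Suc lim_1_over_n)
        then show ?thesis using True by (simp add: y_def)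
      qed (simp add: y_def)
    qed (use x in \<open>auto simp: y_def PiE_def extensional_def\<close>)
    moreover have "y k \<in> ?A" for k
      using x by (auto simp: y_def PiE_def extensional_def intro: less_le_trans[of _ "x 0"])
    moreover have "?A \<subseteq> ?T closure_of ?A"
      by (intro closure_of_subset) auto
    ultimately show "x \<in> ?T closure_of ?A"
      by (intro limitin_closedin[where f = y and F = sequentially, OF _ closedin_closure_of])
        (blast intro: always_eventually, simp)+
  qed
qed

lemma open_core_expansion:
  assumes "expansion_of M real_order"
  shows "expansion_of (open_core M) real_order"
proof -
  let ?C = "{x \<in> cart_power 2. x 0 \<le> x 1} :: (nat \<Rightarrow> real) set"
  have "definable real_order 2 {x \<in> cart_power 2. x 0 < x 1}"
    unfolding definable_def
    by (intro exI[of _ "Rel () [Var 0, Var 1]"]) (auto simp: real_order_def)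
  then have "definable M 2 {x \<in> cart_power 2. x 0 < x 1}"
    using assms by (auto simp: expansion_of_def)
  then have C: "(2, ?C) \<in> rsyms (open_core M)"
    using closure_strict_order by (auto simp: open_core_def)
  have tm: "\<exists>i. t = Var i" if "wf_term real_order t" for t
    using that by (cases t) (auto simp: real_order_def)
  have "\<exists>q. wf_formula (open_core M) q \<and> (\<forall>v. sat (open_core M) v q = sat real_order v p)"
    if "wf_formula real_order p" for p
    using that
  proof (induction p)
    case (Equal s t)
    then obtain i j where "s = Var i" "t = Var j" using tm by (metis wf_formula.simps(1))
    then show ?case by (intro exI[of _ "Equal (Var i) (Var j)"]) auto
  next
    case (Rel r ts)
    then obtain s t where "ts = [s, t]" "wf_term real_order s" "wf_term real_order t"
      by (auto simp: real_order_def numeral_2_eq_2 length_Suc_conv)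
    then obtain i j where ts: "ts = [Var i, Var j]" using tm by blast
    show ?case
      by (rule exI[of _ "Conj (Rel (2, ?C) [Var i, Var j]) (Neg (Equal (Var i) (Var j)))"])
        (use C ts in \<open>auto simp: open_core_def real_order_def\<close>)
  next
    case (Neg p)
    then show ?case by (metis sat.simps(3) wf_formula.simps(3))
  next
    case (Conj p q)
    then show ?case by (metis sat.simps(4) wf_formula.simps(4))
  next
    case (Exists i p)
    then show ?case by (metis sat.simps(5) wf_formula.simps(5))
  qed
  then have transl: "\<exists>q. wf_formula (open_core M) q \<and> (\<forall>v. sat (open_core M) v q = sat real_order v p)"
    if "wf_formula real_order p" for p
    using that by blast
  show ?thesis
    unfolding expansion_of_def
  proof (intro allI impI)
    fix n X assume "definable real_order n X"
    then obtain p c where p: "wf_formula real_order p"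
      and X: "X = {x \<in> cart_power n. sat real_order (\<lambda>i. if i < n then x i else c i) p}"
      unfolding definable_def by blast
    obtain q where q: "wf_formula (open_core M) q" "\<And>v. sat (open_core M) v q = sat real_order v p"
      using transl[OF p] by blast
    have "X = {x \<in> cart_power n. sat (open_core M) (\<lambda>i. if i < n then x i else c i) q}"
      unfolding X q(2) ..
    with q(1) show "definable (open_core M) n X"
      unfolding definable_def by blast
  qed
qed

end

theory Submission
  imports Defs
begin

text \<open>
  Call a predicate \<open>P\<close> on valuations traceable if some definable family \<open>\<Phi>\<^sub>w\<close> separates, for all
  finite \<open>F \<subseteq> P\<close> and \<open>G \<subseteq> - P\<close>, a neighbourhood of \<open>F\<close> from a neighbourhood of \<open>G\<close>. Closed definable
  sets are traceable by their \<open>\<delta>\<close>-neighbourhoods, which is where addition is needed. In an NIP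
  structure traceability passes to projections: by compactness and the covering theorem for set
  systems of finite VC dimension, a bounded intersection of the \<open>\<Phi>\<^sub>w\<close> contains a neighbourhood of
  finitely many chosen lifts and avoids a neighbourhood of a given compact set disjoint from \<open>P\<close>.
  Hence all sets definable in the open core are traceable; this replaces Shelah's theorem on
  externally definable sets.

  A traceable set cannot be dense and codense in a nonempty set \<open>Y\<close>: shrinking balls around points
  of \<open>Y\<close> realizes every pattern of \<open>\<Phi>\<close>, which gives the independence property. Now suppose that \<open>X\<close>
  has neither interior nor isolated points in an open set \<open>J\<close> that it meets. Either \<open>X\<close> is dense and
  codense in some open subset of \<open>J\<close>, or the set of points that are left endpoints of a gap of \<open>X\<close> is
  dense and codense in \<open>closure X \<inter> J\<close>.
\<close>

text \<open>NIP alone does not exclude noise: Q is dense and codense, yet (R,<,+,Q) is NIP. The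
  argument must use that the sets of the open core are built from closed sets, whose defining
  neighbourhoods tolerate small perturbations; traceability records this tolerance. Quantifiers are
  the obstacle. One parameter w handles finitely many points, but refuting \<open>\<exists>a\<close>
  at a single valuation means excluding a whole line of points, and the formula has to be fixed
  before F and G are known. Cutting the line to a compact interval leaves finitely many candidate
  parameters, but their number still depends on F and G. Bounds on the VC dimension of the family
  and of its dual bound in advance how many of them suffice, so one formula with a fixed number of
  parameter tuples serves all F and G. Neighbourhoods rather than points are separated because both
  the compactness argument and the final shrinking argument need decisions that persist
  nearby.\<close>

section \<open>Set systems of finite VC dimension\<close>

definition shattered :: "'a set set \<Rightarrow> 'a set \<Rightarrow> bool" where
  "shattered \<C> S \<longleftrightarrow> (\<forall>T\<subseteq>S. \<exists>C\<in>\<C>. C \<inter> S = T)"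

lemma shatteredD: "shattered \<C> S \<Longrightarrow> T \<subseteq> S \<Longrightarrow> \<exists>C\<in>\<C>. C \<inter> S = T"
  by (simp add: shattered_def)

lemma shattered_subset:
  assumes "shattered \<C> S" "S' \<subseteq> S"
  shows "shattered \<C> S'"
  unfolding shattered_def
proof (intro allI impI)
  fix T assume "T \<subseteq> S'"
  then obtain C where "C \<in> \<C>" "C \<inter> S = T"
    using assms by (meson shattered_def order_trans)
  then show "\<exists>C\<in>\<C>. C \<inter> S' = T"
    using \<open>T \<subseteq> S'\<close> assms(2) by (intro bexI[of _ C]) auto
qed

text \<open>Split the family into the members without x and those with x, the latter with x removed.
  A set shattered by either part is shattered by the whole, and a set shattered by both stays
  shattered after x is added. So the two counts add up even where they overlap.\<close>

lemma Pajor: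
  assumes "finite X" "\<C> \<subseteq> Pow X"
  shows "card \<C> \<le> card {S. S \<subseteq> X \<and> shattered \<C> S}"
  using assms
proof (induction X arbitrary: \<C> rule: finite_induct)
  case empty
  then have "\<C> = {} \<or> \<C> = {{}}" by auto
  then show ?case
    by (auto simp: shattered_def card_eq_0_iff intro!: Suc_leI simp: card_gt_0_iff)
next
  case (insert x X)
  define C0 where "C0 = {C \<in> \<C>. x \<notin> C}"
  define C1 where "C1 = (\<lambda>C. C - {x}) ` {C \<in> \<C>. x \<in> C}"
  define sh where "sh \<D> = {S. S \<subseteq> X \<and> shattered \<D> S}" for \<D>
  have fin: "finite \<C>" "finite (sh \<D>)" for \<D>
    using insert by (auto simp: sh_def intro: finite_subset[of _ "Pow (insert x X)"] finite_subset[of _ "Pow X"])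
  have "card \<C> = card C0 + card {C \<in> \<C>. x \<in> C}"
    unfolding C0_def using fin
    by (subst card_Un_disjoint[symmetric]) (auto intro!: arg_cong[where f = card])
  also have "card {C \<in> \<C>. x \<in> C} = card C1"
    unfolding C1_def by (rule card_image[symmetric]) (auto simp: inj_on_def)
  also have "card C0 + card C1 \<le> card (sh C0) + card (sh C1)"
    unfolding sh_def using insert by (intro add_mono insert.IH) (auto simp: C0_def C1_def)
  also have "\<dots> = card (sh C0 \<union> sh C1) + card (sh C0 \<inter> sh C1)"
    by (rule card_Un_Int) (rule fin)+
  also have "card (sh C0 \<inter> sh C1) = card (insert x ` (sh C0 \<inter> sh C1))"
  proof (rule card_image[symmetric])
    show "inj_on (insert x) (sh C0 \<inter> sh C1)"
      using insert(2) by (auto simp: inj_on_def sh_def)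
  qed
  also have "card (sh C0 \<union> sh C1) + card (insert x ` (sh C0 \<inter> sh C1))
      = card ((sh C0 \<union> sh C1) \<union> insert x ` (sh C0 \<inter> sh C1))"
    using fin insert(2) by (intro card_Un_disjoint[symmetric]) (auto simp: sh_def)
  also have "\<dots> \<le> card {S. S \<subseteq> insert x X \<and> shattered \<C> S}"
  proof (rule card_mono)
    show "finite {S. S \<subseteq> insert x X \<and> shattered \<C> S}"
      using insert by (auto intro: finite_subset[of _ "Pow (insert x X)"])
    have 1: "S \<in> sh C0 \<union> sh C1 \<Longrightarrow> shattered \<C> S" for S
    proof -
      assume S: "S \<in> sh C0 \<union> sh C1"
      then have x: "x \<notin> S" using insert(2) by (auto simp: sh_def)
      show ?thesis
        unfolding shattered_def
      proof (intro allI impI)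
        fix T assume "T \<subseteq> S"
        then consider C where "C \<in> C0" "C \<inter> S = T" | C where "C \<in> C1" "C \<inter> S = T"
          using S shatteredD[of C0 S T] shatteredD[of C1 S T] unfolding sh_def by blast
        then show "\<exists>C\<in>\<C>. C \<inter> S = T"
        proof cases
          case (1 C)
          then show ?thesis by (auto simp: C0_def)
        next
          case (2 C)
          then obtain C' where "C' \<in> \<C>" "C = C' - {x}" by (auto simp: C1_def)
          then show ?thesis using 2 x by (intro bexI[of _ C']) auto
        qed
      qed
    qed
    have 2: "shattered \<C> (insert x S)" if S: "S \<in> sh C0 \<inter> sh C1" for S
      unfolding shattered_def
    proof (intro allI impI)
      fix T assume T: "T \<subseteq> insert x S"
      have x: "x \<notin> S" using S insert(2) by (auto simp: sh_def)
      show "\<exists>C\<in>\<C>. C \<inter> insert x S = T"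
      proof (cases "x \<in> T")
        case True
        from T have "T - {x} \<subseteq> S" by auto
        then obtain C where "C \<in> C1" "C \<inter> S = T - {x}"
          using S shatteredD[of C1 S "T - {x}"] by (auto simp: sh_def)
        then obtain C' where C': "C' \<in> \<C>" "x \<in> C'" "(C' - {x}) \<inter> S = T - {x}"
          by (auto simp: C1_def)
        then have "C' \<inter> insert x S = T" using x True by blast
        then show ?thesis using C' by blast
      next
        case False
        with T have "T \<subseteq> S" by auto
        then obtain C where "C \<in> C0" "C \<inter> S = T"
          using S shatteredD[of C0 S T] by (auto simp: sh_def)
        then show ?thesis using x False by (auto simp: C0_def)
      qed
    qed
    show "(sh C0 \<union> sh C1) \<union> insert x ` (sh C0 \<inter> sh C1)
        \<subseteq> {S. S \<subseteq> insert x X \<and> shattered \<C> S}"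
      using 1 2 by (auto simp: sh_def)
  qed
  finally show ?case .
qed

text \<open>The condition of \<open>independence_property\<close> at a single n, for an arbitrary
  relation. Exchanging the arguments of E gives dual shattering.\<close>

definition shatters :: "('a \<Rightarrow> 'b \<Rightarrow> bool) \<Rightarrow> nat \<Rightarrow> bool" where
  "shatters E n \<longleftrightarrow> (\<exists>a b. \<forall>i<n. \<forall>S\<subseteq>{..<n}. E (a i) (b S) \<longleftrightarrow> i \<in> S)"

lemma shatters_mono: "shatters E n \<Longrightarrow> m \<le> n \<Longrightarrow> shatters E m"
  unfolding shatters_def
proof (elim exE)
  fix a b assume ab: "\<forall>i<n. \<forall>S\<subseteq>{..<n}. E (a i) (b S) \<longleftrightarrow> i \<in> S" and "m \<le> n"
  then have "{..<m} \<subseteq> {..<n}" by simp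
  with ab \<open>m \<le> n\<close> show "\<exists>a b. \<forall>i<m. \<forall>S\<subseteq>{..<m}. E (a i) (b S) \<longleftrightarrow> i \<in> S"
    by (intro exI[of _ a] exI[of _ b]) (meson less_le_trans subset_trans)
qed

lemma shatters_neg: "shatters (\<lambda>a b. \<not> E a b) n \<Longrightarrow> shatters E n"
  unfolding shatters_def
proof (elim exE)
  fix a b assume ab: "\<forall>i<n. \<forall>S\<subseteq>{..<n}. (\<not> E (a i) (b S)) \<longleftrightarrow> i \<in> S"
  have "E (a i) (b ({..<n} - S)) \<longleftrightarrow> i \<in> S" if "i < n" "S \<subseteq> {..<n}" for i S
    using ab[rule_format, of i "{..<n} - S"] that by auto
  then show "\<exists>a b. \<forall>i<n. \<forall>S\<subseteq>{..<n}. E (a i) (b S) \<longleftrightarrow> i \<in> S"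
    by (intro exI[of _ a] exI[of _ "\<lambda>S. b ({..<n} - S)"]) simp
qed

text \<open>Elements of S are labels of points, because the same point may occur at several
  positions of a sample. Enumerating S turns its subsets into the index sets of
  \<open>shatters\<close>.\<close>

lemma shatters_of_shattered:
  assumes "finite S" "card S = n" "\<And>T. T \<subseteq> S \<Longrightarrow> \<exists>c. \<forall>z\<in>S. E (f z) c \<longleftrightarrow> z \<in> T"
  shows "shatters E n"
proof -
  obtain h where h: "bij_betw h {..<n} S"
    using assms(1,2) ex_bij_betw_nat_finite[of S] by (auto simp: atLeast0LessThan)
  have "\<forall>T. \<exists>c. T \<subseteq> {..<n} \<longrightarrow> (\<forall>z\<in>S. E (f z) c \<longleftrightarrow> z \<in> h ` T)"
    using assms(3) h by (metis bij_betw_imp_surj_on image_mono)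
  then obtain b where b: "\<And>T. T \<subseteq> {..<n} \<Longrightarrow> \<forall>z\<in>S. E (f z) (b T) \<longleftrightarrow> z \<in> h ` T"
    by metis
  have "E (f (h i)) (b T) \<longleftrightarrow> i \<in> T" if "i < n" "T \<subseteq> {..<n}" for i T
  proof -
    have "h i \<in> S" using h that by (auto simp: bij_betw_def)
    then have "E (f (h i)) (b T) \<longleftrightarrow> h i \<in> h ` T" using b that by auto
    also have "\<dots> \<longleftrightarrow> i \<in> T"
      using h that inj_on_image_mem_iff[of h "{..<n}" i T] by (auto simp: bij_betw_def)
    finally show ?thesis .
  qed
  then show ?thesis
    unfolding shatters_def by (intro exI[of _ "\<lambda>i. f (h i)"] exI[of _ b]) simp
qed

text \<open>By Pajor's inequality it is enough to count shattered sets, and these have fewer than n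
  elements. A crude bound will do: polynomial growth in \<open>card Z\<close> is all that is needed
  against a power of 2.\<close>

lemma card_traces_le:
  assumes "finite Z" "Z \<noteq> {}" "\<not> shatters E n"
  shows "card ((\<lambda>c. {z \<in> Z. E (f z) c}) ` J) \<le> n * card Z ^ n"
proof -
  let ?\<C> = "(\<lambda>c. {z \<in> Z. E (f z) c}) ` J"
  have "card ?\<C> \<le> card {S. S \<subseteq> Z \<and> shattered ?\<C> S}"
    using assms(1) by (intro Pajor) auto
  also have "\<dots> \<le> card (\<Union>i<n. {S. S \<subseteq> Z \<and> card S = i})"
  proof (rule card_mono)
    show "finite (\<Union>i<n. {S. S \<subseteq> Z \<and> card S = i})" using assms(1) by auto
    show "{S. S \<subseteq> Z \<and> shattered ?\<C> S} \<subseteq> (\<Union>i<n. {S. S \<subseteq> Z \<and> card S = i})"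
    proof safe
      fix S assume S: "S \<subseteq> Z" "shattered ?\<C> S"
      have "card S < n"
      proof (rule ccontr)
        assume "\<not> card S < n"
        then obtain S' where S': "S' \<subseteq> S" "card S' = n" "finite S'"
          using S(1) assms(1) by (metis finite_subset not_less obtain_subset_with_card_n)
        have sh: "shattered ?\<C> S'" using S S' shattered_subset by blast
        have "shatters E n"
        proof (rule shatters_of_shattered[of S'])
          fix T assume "T \<subseteq> S'"
          then obtain c where "c \<in> J" "{z \<in> Z. E (f z) c} \<inter> S' = T"
            using sh by (auto simp: shattered_def)
          then show "\<exists>c. \<forall>z\<in>S'. E (f z) c \<longleftrightarrow> z \<in> T"
            using S S' by (intro exI[of _ c]) auto
        qed (use S' in auto)
        with assms(3) show False by simp
      qed
      then show "S \<in> (\<Union>i<n. {S. S \<subseteq> Z \<and> card S = i})" using S by auto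
    qed
  qed
  also have "\<dots> \<le> (\<Sum>i<n. card {S. S \<subseteq> Z \<and> card S = i})"
    by (rule card_UN_le) auto
  also have "\<dots> \<le> (\<Sum>i<n. card Z ^ n)"
  proof (rule sum_mono)
    fix i assume "i \<in> {..<n}"
    have "card {S. S \<subseteq> Z \<and> card S = i} = card Z choose i"
      using assms(1) by (rule n_subsets)
    also have "\<dots> \<le> card Z ^ i"
      by (cases "i \<le> card Z") (auto simp: binomial_le_pow binomial_eq_0)
    also have "\<dots> \<le> card Z ^ n"
      using \<open>i \<in> {..<n}\<close> assms by (intro power_increasing) (auto simp: card_gt_0_iff Suc_le_eq)
    finally show "card {S. S \<subseteq> Z \<and> card S = i} \<le> card Z ^ n" .
  qed
  finally show ?thesis by simp
qed

section \<open>Epsilon-nets of bounded size\<close>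

text \<open>First moment: the average number of hits is at least k / 4 = 2 * l, while the number of
  hits never exceeds l plus k times the indicator of at least l hits. So at least l hits occur with
  probability at least l / k = 1 / 8.\<close>

lemma card_hits:
  fixes C I :: "'i set"
  assumes fin: "finite I" and C: "C \<subseteq> I" "card I \<le> 4 * card C" and k: "k = 8 * l"
  defines "\<Omega> \<equiv> {..<k} \<rightarrow>\<^sub>E I"
  shows "card I ^ k \<le> 8 * card {y \<in> \<Omega>. l \<le> card {i. i < k \<and> y i \<in> C}}"
proof (cases "l = 0")
  case True
  then have "{y \<in> \<Omega>. l \<le> card {i. i < k \<and> y i \<in> C}} = {..<0} \<rightarrow>\<^sub>E I"
    using k unfolding \<Omega>_def by auto
  then show ?thesis using k True by (simp add: card_PiE)
next
  case False
  let ?h = "\<lambda>y. card {i. i < k \<and> y i \<in> C}"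
  let ?g = "{y \<in> \<Omega>. l \<le> ?h y}"
  have fO: "finite \<Omega>" unfolding \<Omega>_def using fin by (intro finite_PiE) auto
  have cO: "card \<Omega> = card I ^ k" unfolding \<Omega>_def by (simp add: card_PiE)
  have one: "card I ^ k \<le> 4 * card {y \<in> \<Omega>. y i \<in> C}" if "i < k" for i
  proof -
    have "{y \<in> \<Omega>. y i \<in> C} = Pi\<^sub>E {..<k} (\<lambda>j. if j = i then C else I)"
    proof (intro set_eqI)
      fix y
      have "(\<forall>j\<in>{..<k}. y j \<in> I) \<and> y i \<in> C \<longleftrightarrow> (\<forall>j\<in>{..<k}. y j \<in> (if j = i then C else I))"
        using C(1) that by (auto split: if_splits)
      then show "y \<in> {y \<in> \<Omega>. y i \<in> C} \<longleftrightarrow> y \<in> Pi\<^sub>E {..<k} (\<lambda>j. if j = i then C else I)"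
        by (simp only: mem_Collect_eq \<Omega>_def PiE_iff) blast
    qed
    then have "card {y \<in> \<Omega>. y i \<in> C} = (\<Prod>j<k. if j = i then card C else card I)"
      by (simp add: card_PiE if_distrib)
    also have "\<dots> = card C * (\<Prod>j\<in>{..<k} - {i}. card I)"
      using that by (subst prod.remove[of _ i]) (auto intro!: prod.cong)
    also have "\<dots> = card C * card I ^ (k - 1)"
      using that by simp
    finally have eq: "card {y \<in> \<Omega>. y i \<in> C} = card C * card I ^ (k - 1)" .
    have "card I ^ k = card I * card I ^ (k - 1)"
      using that by (metis Suc_diff_1 gr_zeroI not_less0 power_Suc)
    also have "\<dots> \<le> 4 * card C * card I ^ (k - 1)"
      using C by simp
    finally show ?thesis using eq by simp
  qed
  have "k * card I ^ k = (\<Sum>i<k. card I ^ k)" by simp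
  also have "\<dots> \<le> (\<Sum>i<k. 4 * card {y \<in> \<Omega>. y i \<in> C})"
    using one by (intro sum_mono) auto
  also have "\<dots> = 4 * (\<Sum>i<k. \<Sum>y\<in>\<Omega>. of_bool (y i \<in> C))"
    using fO by (simp add: sum_distrib_left of_bool_def sum.If_cases Int_def)
  also have "\<dots> = 4 * (\<Sum>y\<in>\<Omega>. \<Sum>i<k. of_bool (y i \<in> C))"
    by (subst sum.swap) simp
  also have "\<dots> = 4 * (\<Sum>y\<in>\<Omega>. ?h y)"
    by (simp add: of_bool_def sum.If_cases Int_def)
  also have "\<dots> \<le> 4 * (\<Sum>y\<in>\<Omega>. k * of_bool (l \<le> ?h y) + l)"
  proof (intro mult_left_mono sum_mono)
    fix y
    have "?h y \<le> card {..<k}" by (rule card_mono) auto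
    then show "?h y \<le> k * of_bool (l \<le> ?h y) + l" by auto
  qed simp
  also have "\<dots> = 4 * (k * card ?g + l * card I ^ k)"
    using fO cO
    by (simp add: sum.distrib sum_distrib_left[symmetric] of_bool_def sum.If_cases Int_def)
  finally have "l * (8 * card I ^ k) \<le> l * (32 * card ?g + 4 * card I ^ k)"
    using k by (simp add: algebra_simps)
  then have "8 * card I ^ k \<le> 32 * card ?g + 4 * card I ^ k"
    using False by simp
  then show ?thesis by simp
qed

text \<open>Here \<open>(i, False)\<close> and \<open>(i, True)\<close> are the i-th positions of
  two samples, D is the set of positions that are hit, and \<sigma> is the set of coordinates
  exchanged. All of D has to end up in the second sample, which forces the choice at every
  coordinate that meets D. If some \<sigma> qualifies, at least l coordinates meet D, so at most k -
  l = 7 * l choices are free.\<close>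

lemma card_good_swaps:
  fixes D :: "(nat \<times> bool) set"
  assumes "k = 8 * l"
  shows "card {\<sigma>. \<sigma> \<subseteq> {..<k} \<and> (\<forall>i<k. (i, i \<in> \<sigma>) \<notin> D) \<and> l \<le> card {i. i < k \<and> (i, i \<notin> \<sigma>) \<in> D}}
    \<le> 2 ^ (7 * l)" (is "card ?A \<le> _")
proof (cases "?A = {}")
  case False
  let ?H = "{i. i < k \<and> ((i, False) \<in> D \<or> (i, True) \<in> D)}"
  from False obtain \<sigma> where "l \<le> card {i. i < k \<and> (i, i \<notin> \<sigma>) \<in> D}" by auto
  also have "\<dots> \<le> card ?H"
    by (rule card_mono) (auto, (metis (full_types))+)
  finally have l: "l \<le> card ?H" .
  have "inj_on (\<lambda>\<sigma>. \<sigma> - ?H) ?A"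
  proof (rule inj_onI)
    fix \<sigma> \<tau> assume a: "\<sigma> \<in> ?A" "\<tau> \<in> ?A" and eq: "\<sigma> - ?H = \<tau> - ?H"
    have "i \<in> \<sigma> \<longleftrightarrow> i \<in> \<tau>" if "i \<in> ?H" for i
      using a that by (smt (verit) mem_Collect_eq)
    then show "\<sigma> = \<tau>" using eq by blast
  qed
  then have "card ?A = card ((\<lambda>\<sigma>. \<sigma> - ?H) ` ?A)" by (rule card_image[symmetric])
  also have "\<dots> \<le> card (Pow ({..<k} - ?H))"
    by (rule card_mono) auto
  also have "\<dots> = 2 ^ (k - card ?H)"
    by (subst card_Pow) (auto simp: card_Diff_subset subset_iff)
  also have "\<dots> \<le> 2 ^ (7 * l)"
    using l assms by (intro power_increasing) auto
  finally show ?thesis .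
next
  case True
  show ?thesis unfolding True by simp
qed

text \<open>Double sampling: if every sample \<open>x\<close> of length \<open>k\<close> misses some \<open>c\<close>, then a positive proportion of
  the pairs of samples \<open>(x, y)\<close> is bad, i.e. some \<open>c\<close> is missed by \<open>x\<close> but hit often by \<open>y\<close>. Swapping
  coordinates of \<open>x\<close> and \<open>y\<close> at random rarely gives a bad pair, as there are few traces.\<close>

lemma epsilon_net_aux:
  fixes E :: "'i \<Rightarrow> 'c \<Rightarrow> bool" and I :: "'i set"
  assumes fin: "finite I" and ne: "I \<noteq> {}"
    and big: "\<And>c. c \<in> J \<Longrightarrow> card I \<le> 4 * card {i \<in> I. E i c}"
    and vc: "\<not> shatters E n" and k: "k = 8 * l" "0 < l"
    and l: "8 * (n * (16 * l) ^ n) < 2 ^ l"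
  shows "\<exists>Y\<subseteq>I. card Y \<le> k \<and> (\<forall>c\<in>J. \<exists>i\<in>Y. E i c)"
proof (rule ccontr)
  assume "\<not> ?thesis"
  then have contr: "\<exists>c\<in>J. \<forall>i\<in>Y. \<not> E i c" if "Y \<subseteq> I" "card Y \<le> k" for Y
    using that by meson
  define \<Omega> where "\<Omega> = {..<k} \<rightarrow>\<^sub>E I"
  have fO: "finite \<Omega>" unfolding \<Omega>_def using fin by (intro finite_PiE) auto
  have cO: "card \<Omega> = card I ^ k" unfolding \<Omega>_def by (simp add: card_PiE)
  have "\<exists>c\<in>J. \<forall>i<k. \<not> E (x i) c" if "x \<in> \<Omega>" for x
  proof -
    have "x ` {..<k} \<subseteq> I" using that by (auto simp: \<Omega>_def)
    moreover have "card (x ` {..<k}) \<le> k" using card_image_le[of "{..<k}" x] by simp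
    ultimately have "\<exists>c\<in>J. \<forall>i\<in>x ` {..<k}. \<not> E i c" by (rule contr)
    then show ?thesis by auto
  qed
  then obtain c where "\<forall>x\<in>\<Omega>. c x \<in> J \<and> (\<forall>i<k. \<not> E (x i) (c x))"
    using bchoice[of \<Omega> "\<lambda>x c. c \<in> J \<and> (\<forall>i<k. \<not> E (x i) c)"] by blast
  then have c: "\<And>x. x \<in> \<Omega> \<Longrightarrow> c x \<in> J" "\<And>x i. x \<in> \<Omega> \<Longrightarrow> i < k \<Longrightarrow> \<not> E (x i) (c x)"
    by auto
  define Bad where "Bad = (\<lambda>(x, y). \<exists>c\<in>J. (\<forall>i<k. \<not> E (x i) c) \<and> l \<le> card {i. i < k \<and> E (y i) c})"
  define B where "B = {z \<in> \<Omega> \<times> \<Omega>. Bad z}"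
  have fB: "finite B" using fO by (simp add: B_def)
  define swap where "swap \<sigma> = (\<lambda>(x, y).
      (\<lambda>i\<in>{..<k}. if i \<in> \<sigma> then y i else x i :: 'i, \<lambda>i\<in>{..<k}. if i \<in> \<sigma> then x i else y i))"
    for \<sigma> :: "nat set"
  have swap_in: "swap \<sigma> z \<in> \<Omega> \<times> \<Omega>" if "z \<in> \<Omega> \<times> \<Omega>" for \<sigma> z
  proof -
    obtain x y where z: "z = (x, y)" by force
    have "x i \<in> I" "y i \<in> I" if "i < k" for i
      using \<open>z \<in> \<Omega> \<times> \<Omega>\<close> that unfolding z \<Omega>_def by (auto dest: PiE_mem)
    then show ?thesis unfolding z swap_def \<Omega>_def by (simp add: restrict_PiE_iff)
  qed
  have swap_swap: "swap \<sigma> (swap \<sigma> z) = z" if "z \<in> \<Omega> \<times> \<Omega>" for \<sigma> z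
  proof -
    obtain x y where z: "z = (x, y)" by force
    have "x i = undefined" "y i = undefined" if "\<not> i < k" for i
      using \<open>z \<in> \<Omega> \<times> \<Omega>\<close> that unfolding z \<Omega>_def by (auto dest: PiE_arb)
    then show ?thesis unfolding z swap_def by (auto simp: fun_eq_iff)
  qed
  have "card I ^ k * card I ^ k = (\<Sum>x\<in>\<Omega>. card I ^ k)" using cO by simp
  also have "\<dots> \<le> (\<Sum>x\<in>\<Omega>. 8 * card {y \<in> \<Omega>. Bad (x, y)})"
  proof (rule sum_mono)
    fix x assume x: "x \<in> \<Omega>"
    let ?C = "{i \<in> I. E i (c x)}"
    have "card I ^ k \<le> 8 * card {y \<in> \<Omega>. l \<le> card {i. i < k \<and> y i \<in> ?C}}"
      unfolding \<Omega>_def using fin big[OF c(1)[OF x]] k(1) by (intro card_hits) auto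
    also have "\<dots> \<le> 8 * card {y \<in> \<Omega>. Bad (x, y)}"
    proof (intro mult_left_mono card_mono)
      show "{y \<in> \<Omega>. l \<le> card {i. i < k \<and> y i \<in> ?C}} \<subseteq> {y \<in> \<Omega>. Bad (x, y)}"
      proof safe
        fix y assume y: "y \<in> \<Omega>" "l \<le> card {i. i < k \<and> y i \<in> ?C}"
        have "{i. i < k \<and> y i \<in> ?C} = {i. i < k \<and> E (y i) (c x)}"
          using y by (auto simp: \<Omega>_def)
        with y have "l \<le> card {i. i < k \<and> E (y i) (c x)}" by simp
        with c[OF x] show "Bad (x, y)"
          unfolding Bad_def prod.case by (intro bexI[of _ "c x"] conjI) simp_all
      qed
    qed (use fO in auto)
    finally show "card I ^ k \<le> 8 * card {y \<in> \<Omega>. Bad (x, y)}" .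
  qed
  also have "\<dots> = 8 * card (SIGMA x:\<Omega>. {y \<in> \<Omega>. Bad (x, y)})"
    using fO by (simp add: sum_distrib_left)
  also have "(SIGMA x:\<Omega>. {y \<in> \<Omega>. Bad (x, y)}) = B"
    by (auto simp: B_def)
  finally have low: "card I ^ k * card I ^ k \<le> 8 * card B" .
  \<comment> \<open>\<open>swap \<sigma>\<close> is an involution on the pairs of samples, so
    averaging over \<sigma> does not change the proportion of bad pairs.\<close>
  have swaps: "card {z \<in> \<Omega> \<times> \<Omega>. Bad (swap \<sigma> z)} = card B" for \<sigma>
  proof (rule bij_betw_same_card[of "swap \<sigma>"])
    show "bij_betw (swap \<sigma>) {z \<in> \<Omega> \<times> \<Omega>. Bad (swap \<sigma> z)} B"
      by (rule bij_betwI[of _ _ _ "swap \<sigma>"])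
        (use swap_in swap_swap in \<open>auto simp: B_def simp del: mem_Sigma_iff split_paired_All\<close>)
  qed
  have up: "card {\<sigma>. \<sigma> \<subseteq> {..<k} \<and> Bad (swap \<sigma> z)} \<le> n * (16 * l) ^ n * 2 ^ (7 * l)"
    if z: "z \<in> \<Omega> \<times> \<Omega>" for z
  proof -
    obtain x y where xy: "z = (x, y)" by force
    let ?Z = "{..<k} \<times> (UNIV :: bool set)"
    \<comment> \<open>f reads the 16 * l positions of the double sample. Elements of J with the same
      trace on these positions have the same bad swaps, so \<open>card_good_swaps\<close> is applied
      once per trace.\<close>
    define f where "f = (\<lambda>(i, b). if b then y i else x i)"
    let ?T = "(\<lambda>c. {p \<in> ?Z. E (f p) c}) ` J"
    let ?G = "\<lambda>D. {\<sigma>. \<sigma> \<subseteq> {..<k} \<and> (\<forall>i<k. (i, i \<in> \<sigma>) \<notin> D) \<and> l \<le> card {i. i < k \<and> (i, i \<notin> \<sigma>) \<in> D}}"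
    have finT: "finite ?T" by (rule finite_subset[of _ "Pow ?Z"]) auto
    have "{\<sigma>. \<sigma> \<subseteq> {..<k} \<and> Bad (swap \<sigma> z)} \<subseteq> (\<Union>D\<in>?T. ?G D)"
    proof safe
      fix \<sigma> assume s: "\<sigma> \<subseteq> {..<k}" "Bad (swap \<sigma> z)"
      then obtain c where c: "c \<in> J" "\<And>i. i < k \<Longrightarrow> \<not> E (if i \<in> \<sigma> then y i else x i) c"
          "l \<le> card {i. i < k \<and> E ((\<lambda>i\<in>{..<k}. if i \<in> \<sigma> then x i else y i) i) c}"
        by (auto simp: Bad_def swap_def xy)
      have "{i. i < k \<and> E ((\<lambda>i\<in>{..<k}. if i \<in> \<sigma> then x i else y i) i) c}
          = {i. i < k \<and> (i, i \<notin> \<sigma>) \<in> {p \<in> ?Z. E (f p) c}}"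
        by (auto simp: f_def split: if_splits)
      with c s show "\<sigma> \<in> (\<Union>D\<in>?T. ?G D)"
        by (intro UN_I[of "{p \<in> ?Z. E (f p) c}"] imageI) (auto simp: f_def split: if_splits)
    qed
    then have "card {\<sigma>. \<sigma> \<subseteq> {..<k} \<and> Bad (swap \<sigma> z)} \<le> card (\<Union>D\<in>?T. ?G D)"
      by (intro card_mono finite_subset[of "\<Union>D\<in>?T. ?G D" "Pow {..<k}"]) auto
    also have "\<dots> \<le> (\<Sum>D\<in>?T. card (?G D))" by (rule card_UN_le[OF finT])
    also have "\<dots> \<le> (\<Sum>D\<in>?T. 2 ^ (7 * l))"
      using k(1) by (intro sum_mono card_good_swaps)
    also have "\<dots> = card ?T * 2 ^ (7 * l)" by simp
    also have "card ?T \<le> n * card ?Z ^ n"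
      using vc k by (intro card_traces_le) (auto simp: lessThan_empty_iff)
    also have "card ?Z = 16 * l" using k(1) by (simp add: card_cartesian_product)
    finally show ?thesis by simp
  qed
  have "2 ^ k * card B = (\<Sum>\<sigma>\<in>Pow {..<k}. card {z \<in> \<Omega> \<times> \<Omega>. Bad (swap \<sigma> z)})"
    using swaps by (simp add: card_Pow)
  also have "\<dots> = (\<Sum>\<sigma>\<in>Pow {..<k}. \<Sum>z\<in>\<Omega> \<times> \<Omega>. of_bool (Bad (swap \<sigma> z)))"
    using fO by (simp add: of_bool_def sum.If_cases Int_def)
  also have "\<dots> = (\<Sum>z\<in>\<Omega> \<times> \<Omega>. \<Sum>\<sigma>\<in>Pow {..<k}. of_bool (Bad (swap \<sigma> z)))"
    by (rule sum.swap)
  also have "\<dots> = (\<Sum>z\<in>\<Omega> \<times> \<Omega>. card {\<sigma>. \<sigma> \<subseteq> {..<k} \<and> Bad (swap \<sigma> z)})"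
    by (simp add: of_bool_def sum.If_cases Int_def)
  also have "\<dots> \<le> (\<Sum>z\<in>\<Omega> \<times> \<Omega>. n * (16 * l) ^ n * 2 ^ (7 * l))"
    by (rule sum_mono) (rule up)
  also have "\<dots> = card I ^ k * card I ^ k * (n * (16 * l) ^ n * 2 ^ (7 * l))"
    using cO by (simp add: card_cartesian_product)
  also have "\<dots> \<le> 8 * card B * (n * (16 * l) ^ n * 2 ^ (7 * l))"
    by (rule mult_right_mono[OF low]) simp
  \<comment> \<open>For each pair, at most n * (16 * l) ^ n traces with 2 ^ (7 * l) swaps each are
    bad, out of 2 ^ (8 * l) swaps. The other factor 8 is the inverse of the probability in
    \<open>card_hits\<close>. This is where the hypothesis on l comes from.\<close>
  finally have "(2 ^ (7 * l) * card B) * 2 ^ l \<le> (2 ^ (7 * l) * card B) * (8 * (n * (16 * l) ^ n))"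
    using k(1) by (simp add: power_add[symmetric] algebra_simps)
  moreover have "card B > 0"
  proof -
    have "card I > 0" using fin ne by (simp add: card_gt_0_iff)
    with low show ?thesis by (metis gr_zeroI mult_0_right mult_pos_pos not_less zero_less_power)
  qed
  ultimately have "2 ^ l \<le> 8 * (n * (16 * l) ^ n)"
    by simp
  with l show False by simp
qed

lemma polynomial_less_power_two: "\<exists>l>0. 8 * (n * (16 * l) ^ n) < (2::nat) ^ l"
proof (cases "n = 0")
  case False
  \<comment> \<open>Since r ^ n = 2, the quotient l ^ n / 2 ^ l is the n-th power of l / r ^ l,
    which tends to 0.\<close>
  define r where "r = root n 2"
  have r: "r > 1" "r ^ n = 2"
    using False by (auto simp: r_def)
  have "(\<lambda>l. 8 * real n * 16 ^ n * (of_nat l / r ^ l) ^ n) \<longlonglongrightarrow> 8 * real n * 16 ^ n * 0 ^ n"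
    using r by (intro tendsto_intros lim_n_over_pown) auto
  then have "(\<lambda>l. 8 * real n * 16 ^ n * (of_nat l / r ^ l) ^ n) \<longlonglongrightarrow> 0"
    using False by (simp only: power_0_left if_False mult_zero_right)
  then have "\<forall>\<^sub>F l in sequentially. 8 * real n * 16 ^ n * (of_nat l / r ^ l) ^ n < 1"
    by (rule order_tendstoD) simp
  then obtain L where L: "\<And>l. l \<ge> L \<Longrightarrow> 8 * real n * 16 ^ n * (of_nat l / r ^ l) ^ n < 1"
    unfolding eventually_sequentially by blast
  define l where "l = Suc L"
  have "(r ^ l) ^ n = 2 ^ l"
    using r by (metis mult.commute power_mult)
  then have "8 * real n * 16 ^ n * real l ^ n / 2 ^ l < 1"
    using L[of l] by (simp add: l_def power_divide)
  then have "real (8 * (n * (16 * l) ^ n)) < real (2 ^ l)"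
    by (simp add: power_mult_distrib mult_ac)
  then have "8 * (n * (16 * l) ^ n) < 2 ^ l"
    by (simp only: of_nat_less_iff)
  then show ?thesis by (intro exI[of _ l]) (simp add: l_def)
qed auto

text \<open>The density 1/4 serves two callers: \<open>weighted_net\<close> wants a b that misses at
  most a quarter of the weight, and \<open>bounded_cover_finite\<close> applies it to sets of
  density 1/2.\<close>

lemma epsilon_net:
  obtains k where "\<And>(E :: 'i \<Rightarrow> 'c \<Rightarrow> bool) I J. finite I \<Longrightarrow> I \<noteq> {} \<Longrightarrow> \<not> shatters E n
      \<Longrightarrow> (\<And>c. c \<in> J \<Longrightarrow> card I \<le> 4 * card {i \<in> I. E i c})
      \<Longrightarrow> \<exists>Y\<subseteq>I. card Y \<le> k \<and> (\<forall>c\<in>J. \<exists>i\<in>Y. E i c)"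
proof -
  obtain l where "0 < l" "8 * (n * (16 * l) ^ n) < (2::nat) ^ l"
    using polynomial_less_power_two by blast
  then show thesis
    by (intro that[of "8 * l"] epsilon_net_aux[of _ _ _ n "8 * l" l]) auto
qed

section \<open>Covers of bounded size from weights and duality\<close>

text \<open>Weights become multiplicities. If every b missed more than a quarter of the total
  weight, the sets of missed points would have a net of at most k points, and no b could cover that
  net, against the assumption. Copies of a point are indistinguishable for E, so they do not help to
  shatter.\<close>

lemma weighted_net:
  obtains k where "\<And>(E :: 'p \<Rightarrow> 'b \<Rightarrow> bool) P B (m :: 'p \<Rightarrow> nat). finite P \<Longrightarrow> \<not> shatters E n
      \<Longrightarrow> (\<And>Q. Q \<subseteq> P \<Longrightarrow> card Q \<le> k \<Longrightarrow> \<exists>b\<in>B. \<forall>p\<in>Q. E p b)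
      \<Longrightarrow> \<exists>b\<in>B. 4 * (\<Sum>p | p \<in> P \<and> \<not> E p b. m p) \<le> (\<Sum>p\<in>P. m p)"
proof -
  obtain k where k: "\<And>(E :: 'p \<times> nat \<Rightarrow> 'b \<Rightarrow> bool) I J. finite I \<Longrightarrow> I \<noteq> {} \<Longrightarrow> \<not> shatters E n
      \<Longrightarrow> (\<And>c. c \<in> J \<Longrightarrow> card I \<le> 4 * card {i \<in> I. E i c})
      \<Longrightarrow> \<exists>Y\<subseteq>I. card Y \<le> k \<and> (\<forall>c\<in>J. \<exists>i\<in>Y. E i c)"
    using epsilon_net[where ?'i = "'p \<times> nat" and ?'c = 'b] by blast
  show thesis
  proof (rule that[of k])
    fix E :: "'p \<Rightarrow> 'b \<Rightarrow> bool" and P B and m :: "'p \<Rightarrow> nat"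
    assume fin: "finite P" and vc: "\<not> shatters E n"
      and small: "\<And>Q. Q \<subseteq> P \<Longrightarrow> card Q \<le> k \<Longrightarrow> \<exists>b\<in>B. \<forall>p\<in>Q. E p b"
    define I where "I = (SIGMA p:P. {..<m p})"
    define E' where "E' q b \<longleftrightarrow> \<not> E (fst q) b" for q :: "'p \<times> nat" and b
    have cI: "card I = (\<Sum>p\<in>P. m p)" using fin by (simp add: I_def)
    have cE: "card {i \<in> I. E' i b} = (\<Sum>p | p \<in> P \<and> \<not> E p b. m p)" for b
    proof -
      have "{i \<in> I. E' i b} = (SIGMA p:{p \<in> P. \<not> E p b}. {..<m p})"
        by (auto simp: I_def E'_def)
      then show ?thesis using fin by simp
    qed
    show "\<exists>b\<in>B. 4 * (\<Sum>p | p \<in> P \<and> \<not> E p b. m p) \<le> (\<Sum>p\<in>P. m p)"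
    proof (rule ccontr)
      assume "\<not> ?thesis"
      then have big: "card I < 4 * card {i \<in> I. E' i b}" if "b \<in> B" for b
        using that unfolding cI cE by (meson not_less)
      have "\<exists>b. b \<in> B" using small[of "{}"] by auto
      then have "I \<noteq> {}" using big by fastforce
      moreover have "\<not> shatters E' n"
      proof
        assume "shatters E' n"
        then obtain a b where ab: "\<And>i S. i < n \<Longrightarrow> S \<subseteq> {..<n} \<Longrightarrow> E' (a i) (b S) \<longleftrightarrow> i \<in> S"
          unfolding shatters_def by metis
        have "E (fst (a i)) (b ({..<n} - S)) \<longleftrightarrow> i \<in> S" if "i < n" "S \<subseteq> {..<n}" for i S
          using ab[of i "{..<n} - S"] that by (auto simp: E'_def)
        then have "shatters E n"
          unfolding shatters_def
          by (intro exI[of _ "\<lambda>i. fst (a i)"] exI[of _ "\<lambda>S. b ({..<n} - S)"]) simp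
        with vc show False by simp
      qed
      moreover have "finite I" using fin by (simp add: I_def)
      ultimately obtain Y where Y: "Y \<subseteq> I" "card Y \<le> k" "\<forall>b\<in>B. \<exists>i\<in>Y. E' i b"
        using k[of I E' B] big by (meson less_imp_le)
      have "card (fst ` Y) \<le> k"
        using Y \<open>finite I\<close> by (meson card_image_le finite_subset le_trans)
      moreover have "fst ` Y \<subseteq> P" using Y(1) by (auto simp: I_def)
      ultimately obtain b where "b \<in> B" "\<forall>p\<in>fst ` Y. E p b" using small by blast
      with Y(3) show False by (auto simp: E'_def)
    qed
  qed
qed

text \<open>Multiplicative weights: halving the weight of every point covered by the chosen \<open>b\<close> makes the
  total weight decay like \<open>(5/8)^T\<close>, faster than the weight of a point that is covered by
  fewer than half of the \<open>T\<close> choices.\<close>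

lemma half_cover:
  fixes E :: "'p \<Rightarrow> 'b \<Rightarrow> bool"
  assumes fin: "finite P"
    and step: "\<And>m :: 'p \<Rightarrow> nat. \<exists>b\<in>B. 4 * (\<Sum>p | p \<in> P \<and> \<not> E p b. m p) \<le> (\<Sum>p\<in>P. m p)"
  shows "\<exists>bs. bs \<noteq> [] \<and> set bs \<subseteq> B \<and> (\<forall>p\<in>P. length bs \<le> 2 * length (filter (E p) bs))"
proof -
  define c where "c bs p = length (filter (E p) bs)" for bs p
  have pot: "\<exists>bs. length bs = T \<and> set bs \<subseteq> B \<and> (\<Sum>p\<in>P. (1/2 :: real) ^ c bs p) \<le> (5/8) ^ T * card P" for T
  proof (induction T)
    case 0
    then show ?case by (simp add: c_def)
  next
    case (Suc T)
    then obtain bs where bs: "length bs = T" "set bs \<subseteq> B"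
      "(\<Sum>p\<in>P. (1/2 :: real) ^ c bs p) \<le> (5/8) ^ T * card P" by blast
    have cT: "c bs p \<le> T" for p using bs(1) by (auto simp: c_def)
    let ?w = "\<lambda>p. (1/2 :: real) ^ c bs p"
    \<comment> \<open>The weight (1/2) ^ c is scaled by 2 ^ T, because \<open>step\<close> is about
      natural weights.\<close>
    obtain b where b: "b \<in> B"
      "4 * (\<Sum>p | p \<in> P \<and> \<not> E p b. 2 ^ (T - c bs p)) \<le> (\<Sum>p\<in>P. 2 ^ (T - c bs p) :: nat)"
      using step by blast
    have w: "real (2 ^ (T - c bs p)) = 2 ^ T * ?w p" for p
    proof -
      have "(2 :: real) ^ T = 2 ^ (T - c bs p) * 2 ^ c bs p"
        using cT[of p] by (simp flip: power_add)
      then show ?thesis by (simp add: power_one_over)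
    qed
    have "real (4 * (\<Sum>p | p \<in> P \<and> \<not> E p b. 2 ^ (T - c bs p))) \<le> real (\<Sum>p\<in>P. 2 ^ (T - c bs p))"
      using b(2) by (simp only: of_nat_le_iff)
    then have "2 ^ T * (4 * (\<Sum>p | p \<in> P \<and> \<not> E p b. ?w p)) \<le> 2 ^ T * (\<Sum>p\<in>P. ?w p)"
      unfolding of_nat_mult of_nat_sum w sum_distrib_left[symmetric] by (simp add: mult_ac)
    then have le: "4 * (\<Sum>p | p \<in> P \<and> \<not> E p b. ?w p) \<le> (\<Sum>p\<in>P. ?w p)" by simp
    \<comment> \<open>Covered points lose half of their weight. The uncovered ones carry at most 1/4
      of the total, so the total shrinks by a factor of at most 1/2 + 1/8 = 5/8.\<close>
    have "(\<Sum>p\<in>P. (1/2 :: real) ^ c (b # bs) p) = (\<Sum>p\<in>P. ?w p / 2 + (if E p b then 0 else ?w p / 2))"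
      by (rule sum.cong) (auto simp: c_def)
    also have "\<dots> = (\<Sum>p\<in>P. ?w p) / 2 + (\<Sum>p | p \<in> P \<and> \<not> E p b. ?w p) / 2"
      using fin by (simp add: sum.distrib sum_divide_distrib sum.If_cases Int_def)
    also have "\<dots> \<le> 5 / 8 * (\<Sum>p\<in>P. ?w p)" using le by simp
    also have "\<dots> \<le> 5 / 8 * ((5/8) ^ T * card P)" using bs(3) by simp
    finally show ?case using bs b(1) by (intro exI[of _ "b # bs"]) simp
  qed
  \<comment> \<open>After 2 * s rounds the total weight is at most (25/64) ^ s * card P = (1/2) ^ s
    * ((25/32) ^ s * card P). Once the last factor is below 1, no point can have been covered fewer
    than s times, as its weight alone would be at least (1/2) ^ s.\<close>
  have "(\<lambda>s. (25/32 :: real) ^ s * card P) \<longlonglongrightarrow> 0 * real (card P)"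
    by (intro tendsto_mult tendsto_const LIMSEQ_power_zero) simp
  then have "\<forall>\<^sub>F s in sequentially. (25/32 :: real) ^ s * card P < 1"
    by (intro order_tendstoD(2)[of _ "0 * real (card P)"]) auto
  then obtain S where S: "\<And>s. s \<ge> S \<Longrightarrow> (25/32 :: real) ^ s * card P < 1"
    unfolding eventually_sequentially by blast
  define s where "s = Suc S"
  obtain bs where bs: "length bs = 2 * s" "set bs \<subseteq> B"
    "(\<Sum>p\<in>P. (1/2 :: real) ^ c bs p) \<le> (5/8) ^ (2 * s) * card P" using pot by blast
  have "s \<le> c bs p" if "p \<in> P" for p
  proof (rule ccontr)
    assume "\<not> s \<le> c bs p"
    then have "(1/2 :: real) ^ s \<le> (1/2) ^ c bs p" by (intro power_decreasing) auto
    also have "\<dots> \<le> (\<Sum>p\<in>P. (1/2 :: real) ^ c bs p)"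
      using that fin by (intro member_le_sum) auto
    also have "\<dots> \<le> (5/8) ^ (2 * s) * card P" by (rule bs(3))
    also have "(5/8 :: real) ^ (2 * s) = (1/2) ^ s * (25/32) ^ s"
      by (simp add: power_mult power_mult_distrib[symmetric] power2_eq_square)
    finally have "(1/2 :: real) ^ s * 1 \<le> (1/2) ^ s * ((25/32) ^ s * card P)"
      by (simp only: mult.assoc mult_1_right)
    then have "1 \<le> (25/32 :: real) ^ s * card P"
      by (subst (asm) mult_le_cancel_left_pos) auto
    with S[of s] show False by (simp add: s_def)
  qed
  then have "length bs \<le> 2 * length (filter (E p) bs)" if "p \<in> P" for p
    using bs(1) that by (simp add: c_def)
  moreover have "bs \<noteq> []" using bs(1) by (auto simp: s_def)
  ultimately show ?thesis using bs(2) by blast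
qed

text \<open>\<open>half_cover\<close> gives a list of unbounded length in which at least half of the
  entries cover any given p. In the dual family, whose points are positions of the list, the sets of
  covering positions have density 1/2, so a net of at most m positions already covers P. Positions
  are used because entries may repeat.\<close>

lemma bounded_cover_finite:
  obtains k m where "\<And>(E :: 'p \<Rightarrow> 'b \<Rightarrow> bool) P B. finite P \<Longrightarrow> \<not> shatters E n
      \<Longrightarrow> \<not> shatters (\<lambda>b p. E p b) n
      \<Longrightarrow> (\<And>Q. Q \<subseteq> P \<Longrightarrow> card Q \<le> k \<Longrightarrow> \<exists>b\<in>B. \<forall>p\<in>Q. E p b)
      \<Longrightarrow> \<exists>C\<subseteq>B. finite C \<and> card C \<le> m \<and> (\<forall>p\<in>P. \<exists>b\<in>C. E p b)"
proof -
  obtain k where k: "\<And>(E :: 'p \<Rightarrow> 'b \<Rightarrow> bool) P B (m :: 'p \<Rightarrow> nat). finite P \<Longrightarrow> \<not> shatters E n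
      \<Longrightarrow> (\<And>Q. Q \<subseteq> P \<Longrightarrow> card Q \<le> k \<Longrightarrow> \<exists>b\<in>B. \<forall>p\<in>Q. E p b)
      \<Longrightarrow> \<exists>b\<in>B. 4 * (\<Sum>p | p \<in> P \<and> \<not> E p b. m p) \<le> (\<Sum>p\<in>P. m p)"
    using weighted_net[where ?'p = 'p and ?'b = 'b] by blast
  obtain m where m: "\<And>(E :: nat \<Rightarrow> 'p \<Rightarrow> bool) I J. finite I \<Longrightarrow> I \<noteq> {} \<Longrightarrow> \<not> shatters E n
      \<Longrightarrow> (\<And>c. c \<in> J \<Longrightarrow> card I \<le> 4 * card {i \<in> I. E i c})
      \<Longrightarrow> \<exists>Y\<subseteq>I. card Y \<le> m \<and> (\<forall>c\<in>J. \<exists>i\<in>Y. E i c)"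
    using epsilon_net[where ?'i = nat and ?'c = 'p] by blast
  show thesis
  proof (rule that[of k m])
    fix E :: "'p \<Rightarrow> 'b \<Rightarrow> bool" and P B
    assume fin: "finite P" and vc: "\<not> shatters E n" and vc': "\<not> shatters (\<lambda>b p. E p b) n"
      and small: "\<And>Q. Q \<subseteq> P \<Longrightarrow> card Q \<le> k \<Longrightarrow> \<exists>b\<in>B. \<forall>p\<in>Q. E p b"
    obtain bs where bs: "bs \<noteq> []" "set bs \<subseteq> B" "\<And>p. p \<in> P \<Longrightarrow> length bs \<le> 2 * length (filter (E p) bs)"
      using half_cover[of P B E] k[OF fin vc small] fin by blast
    define I where "I = {..<length bs}"
    define E' where "E' i p = E p (bs ! i)" for i p
    have "length bs \<le> 4 * card {i \<in> I. E' i p}" if "p \<in> P" for p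
      using bs(3)[OF that] by (simp add: length_filter_conv_card E'_def I_def)
    moreover have "\<not> shatters E' n"
    proof
      assume "shatters E' n"
      then obtain a b where ab: "\<forall>i<n. \<forall>S\<subseteq>{..<n}. E (b S) (bs ! a i) \<longleftrightarrow> i \<in> S"
        unfolding shatters_def E'_def by blast
      then have "shatters (\<lambda>b p. E p b) n"
        unfolding shatters_def by (intro exI[of _ "\<lambda>i. bs ! a i"] exI[of _ b])
      with vc' show False by simp
    qed
    ultimately obtain Y where Y: "Y \<subseteq> I" "card Y \<le> m" "\<forall>p\<in>P. \<exists>i\<in>Y. E' i p"
      using m[of I E' P] bs(1) by (auto simp: I_def lessThan_empty_iff)
    have "finite Y" using Y(1) by (rule finite_subset) (simp add: I_def)
    show "\<exists>C\<subseteq>B. finite C \<and> card C \<le> m \<and> (\<forall>p\<in>P. \<exists>b\<in>C. E p b)"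
    proof (intro exI[of _ "(!) bs ` Y"] conjI)
      show "(!) bs ` Y \<subseteq> B" using Y(1) bs(2) by (auto simp: I_def subset_iff)
      show "card ((!) bs ` Y) \<le> m" using Y(2) card_image_le[OF \<open>finite Y\<close>] le_trans by blast
      show "\<forall>p\<in>P. \<exists>b\<in>(!) bs ` Y. E p b" using Y(3) by (auto simp: E'_def)
    qed (use \<open>finite Y\<close> in simp)
  qed
qed

text \<open>Only finitely many traces on a finite \<open>B\<close> matter, so \<open>P\<close> may be infinite.\<close>

lemma bounded_cover:
  obtains k m where "\<And>(E :: 'p \<Rightarrow> 'b \<Rightarrow> bool) P B. finite B \<Longrightarrow> \<not> shatters E n
      \<Longrightarrow> \<not> shatters (\<lambda>b p. E p b) n
      \<Longrightarrow> (\<And>Q. Q \<subseteq> P \<Longrightarrow> finite Q \<Longrightarrow> card Q \<le> k \<Longrightarrow> \<exists>b\<in>B. \<forall>p\<in>Q. E p b)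
      \<Longrightarrow> \<exists>C\<subseteq>B. finite C \<and> card C \<le> m \<and> (\<forall>p\<in>P. \<exists>b\<in>C. E p b)"
proof -
  obtain k m where km: "\<And>(E :: 'p \<Rightarrow> 'b \<Rightarrow> bool) P B. finite P \<Longrightarrow> \<not> shatters E n
      \<Longrightarrow> \<not> shatters (\<lambda>b p. E p b) n
      \<Longrightarrow> (\<And>Q. Q \<subseteq> P \<Longrightarrow> card Q \<le> k \<Longrightarrow> \<exists>b\<in>B. \<forall>p\<in>Q. E p b)
      \<Longrightarrow> \<exists>C\<subseteq>B. finite C \<and> card C \<le> m \<and> (\<forall>p\<in>P. \<exists>b\<in>C. E p b)"
    using bounded_cover_finite[where ?'p = 'p and ?'b = 'b] by blast
  show thesis
  proof (rule that[of k m])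
    fix E :: "'p \<Rightarrow> 'b \<Rightarrow> bool" and P B
    assume fin: "finite B" and vc: "\<not> shatters E n" "\<not> shatters (\<lambda>b p. E p b) n"
      and small: "\<And>Q. Q \<subseteq> P \<Longrightarrow> finite Q \<Longrightarrow> card Q \<le> k \<Longrightarrow> \<exists>b\<in>B. \<forall>p\<in>Q. E p b"
    let ?t = "\<lambda>p. {b \<in> B. E p b}"
    have "finite (?t ` P)" by (rule finite_subset[of _ "Pow B"]) (use fin in auto)
    then obtain P' where P': "P' \<subseteq> P" "finite P'" "?t ` P = ?t ` P'"
      using finite_subset_image[of "?t ` P" ?t P] by blast
    have "\<exists>C\<subseteq>B. finite C \<and> card C \<le> m \<and> (\<forall>p\<in>P'. \<exists>b\<in>C. E p b)"
      using P' vc by (intro km small) (auto intro: finite_subset)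
    then obtain C where C: "C \<subseteq> B" "finite C" "card C \<le> m" "\<forall>p\<in>P'. \<exists>b\<in>C. E p b" by blast
    have "\<exists>b\<in>C. E p b" if "p \<in> P" for p
    proof -
      have "?t p \<in> ?t ` P'" using that unfolding P'(3)[symmetric] by (rule imageI)
      then obtain p' where p': "p' \<in> P'" "?t p = ?t p'" by (rule imageE)
      then obtain b where b: "b \<in> C" "E p' b" using C(4) by auto
      then have "b \<in> ?t p'" using C(1) by auto
      then have "b \<in> ?t p" unfolding p'(2) .
      then show ?thesis using b(1) by auto
    qed
    with C show "\<exists>C\<subseteq>B. finite C \<and> card C \<le> m \<and> (\<forall>p\<in>P. \<exists>b\<in>C. E p b)"
      by (intro exI[of _ C]) simp
  qed
qed

section \<open>Definable predicates on valuations\<close>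

fun term_vars :: "'f fo_term \<Rightarrow> nat set" where
  "term_vars (Var i) = {i}"
| "term_vars (App f ts) = (\<Union>t\<in>set ts. term_vars t)"

fun free_vars :: "('f, 'r) fo_formula \<Rightarrow> nat set" where
  "free_vars (Equal s t) = term_vars s \<union> term_vars t"
| "free_vars (Rel r ts) = (\<Union>t\<in>set ts. term_vars t)"
| "free_vars (Neg p) = free_vars p"
| "free_vars (Conj p q) = free_vars p \<union> free_vars q"
| "free_vars (Exists i p) = free_vars p - {i}"

lemma finite_term_vars: "finite (term_vars t)"
  by (induction t) auto

lemma finite_free_vars: "finite (free_vars p)"
  by (induction p) (auto simp: finite_term_vars)

lemma eval_term_cong: "(\<And>i. i \<in> term_vars t \<Longrightarrow> v i = w i) \<Longrightarrow> eval_term M v t = eval_term M w t"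
proof (induction t)
  case (App f ts)
  then have "map (eval_term M v) ts = map (eval_term M w) ts" by (intro map_cong) auto
  then show ?case by (simp only: eval_term.simps)
qed simp

lemma sat_cong: "(\<And>i. i \<in> free_vars p \<Longrightarrow> v i = w i) \<Longrightarrow> sat M v p \<longleftrightarrow> sat M w p"
proof (induction p arbitrary: v w)
  case (Equal s t)
  then show ?case using eval_term_cong[of s v w M] eval_term_cong[of t v w M] by simp
next
  case (Rel r ts)
  then have "map (eval_term M v) ts = map (eval_term M w) ts"
    by (intro map_cong eval_term_cong) auto
  then show ?case by (simp only: sat.simps)
next
  case (Neg p)
  have "sat M v p \<longleftrightarrow> sat M w p" by (rule Neg.IH) (use Neg.prems in simp)
  then show ?case by simp
next
  case (Conj p q)
  have "sat M v p \<longleftrightarrow> sat M w p" "sat M v q \<longleftrightarrow> sat M w q"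
    by (rule Conj.IH; use Conj.prems in simp)+
  then show ?case by simp
next
  case (Exists i p)
  have "sat M (v(i := a)) p \<longleftrightarrow> sat M (w(i := a)) p" for a
    by (rule Exists.IH) (use Exists.prems in auto)
  then show ?case by simp
qed

fun rename_term :: "(nat \<Rightarrow> nat) \<Rightarrow> 'f fo_term \<Rightarrow> 'f fo_term" where
  "rename_term \<rho> (Var i) = Var (\<rho> i)"
| "rename_term \<rho> (App f ts) = App f (map (rename_term \<rho>) ts)"

text \<open>The bound variable is replaced by one beyond the images of all free variables, so no
  capture occurs even if \<rho> is not injective. Inserting 0 keeps \<open>Max\<close> meaningful
  for sentences.\<close>

fun rename :: "(nat \<Rightarrow> nat) \<Rightarrow> ('f, 'r) fo_formula \<Rightarrow> ('f, 'r) fo_formula" where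
  "rename \<rho> (Equal s t) = Equal (rename_term \<rho> s) (rename_term \<rho> t)"
| "rename \<rho> (Rel r ts) = Rel r (map (rename_term \<rho>) ts)"
| "rename \<rho> (Neg p) = Neg (rename \<rho> p)"
| "rename \<rho> (Conj p q) = Conj (rename \<rho> p) (rename \<rho> q)"
| "rename \<rho> (Exists i p) =
    (let j = Suc (Max (insert 0 (\<rho> ` free_vars p))) in Exists j (rename (\<rho>(i := j)) p))"

lemma eval_rename_term: "eval_term M v (rename_term \<rho> t) = eval_term M (\<lambda>i. v (\<rho> i)) t"
proof (induction t)
  case (App f ts)
  then have "map (\<lambda>t. eval_term M v (rename_term \<rho> t)) ts = map (eval_term M (\<lambda>i. v (\<rho> i))) ts"
    by (intro map_cong) auto
  then show ?case by (simp only: rename_term.simps eval_term.simps list.map_comp comp_def)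
qed simp

lemma wf_rename_term: "wf_term M t \<Longrightarrow> wf_term M (rename_term \<rho> t)"
  by (induction t) auto

lemma wf_rename: "wf_formula M p \<Longrightarrow> wf_formula M (rename \<rho> p)"
  by (induction p arbitrary: \<rho>) (auto simp: wf_rename_term Let_def)

lemma sat_rename: "sat M v (rename \<rho> p) \<longleftrightarrow> sat M (v \<circ> \<rho>) p"
  unfolding comp_def
proof (induction p arbitrary: v \<rho>)
  case (Equal s t)
  then show ?case by (simp add: eval_rename_term)
next
  case (Rel r ts)
  show ?case by (simp add: eval_rename_term comp_def)
next
  case (Exists i p)
  define j where "j = Suc (Max (insert 0 (\<rho> ` free_vars p)))"
  have fresh: "\<rho> k \<noteq> j" if "k \<in> free_vars p" for k
  proof -
    have "\<rho> k \<le> Max (insert 0 (\<rho> ` free_vars p))"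
      using that by (intro Max_ge) (auto simp: finite_free_vars)
    then show ?thesis by (simp add: j_def)
  qed
  have "sat M (v(j := a)) (rename (\<rho>(i := j)) p) \<longleftrightarrow> sat M ((\<lambda>k. v (\<rho> k))(i := a)) p" for a
    unfolding Exists.IH by (rule sat_cong) (use fresh in auto)
  then show ?case by (simp add: Let_def j_def)
qed simp_all

section \<open>Closure properties of definable predicates\<close>

text \<open>Codes a pair of infinite tuples as one, so that object variables and parameters can be
  kept apart without tracking arities.\<close>

definition interleave :: "(nat \<Rightarrow> 'a) \<Rightarrow> (nat \<Rightarrow> 'a) \<Rightarrow> nat \<Rightarrow> 'a" where
  "interleave u v = (\<lambda>j. if even j then u (j div 2) else v (j div 2))"

lemma interleave_even [simp]: "interleave u v (2 * i) = u i"
  and interleave_odd [simp]: "interleave u v (Suc (2 * i)) = v i"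
  by (auto simp: interleave_def)

lemma interleave_odd_even [simp]: "interleave u v (Suc (4 * i)) = v (2 * i)"
  and interleave_odd_odd [simp]: "interleave u v (Suc (Suc (Suc (4 * i)))) = v (Suc (2 * i))"
  by (simp_all add: interleave_def)

lemma nat_even_odd_cases:
  obtains (even) i where "(j :: nat) = 2 * i" | (odd) i where "j = Suc (2 * i)"
proof (cases "even j")
  case False
  then obtain i where "j = 2 * i + 1" by (elim oddE)
  then show ?thesis by (intro odd[of i]) simp
qed (auto elim: evenE intro: even)

text \<open>Acts on the parameter half only. With h selecting a block of coordinates, it extracts
  one of several parameter tuples coded in a single tuple.\<close>

definition reindex_params :: "(nat \<Rightarrow> nat) \<Rightarrow> nat \<Rightarrow> nat" where
  "reindex_params h j = (if even j then j else Suc (2 * h (j div 2)))"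

lemma interleave_reindex_params: "interleave v w \<circ> reindex_params h = interleave v (w \<circ> h)"
proof
  show "(interleave v w \<circ> reindex_params h) j = interleave v (w \<circ> h) j" for j
    by (cases j rule: nat_even_odd_cases) (simp_all add: reindex_params_def)
qed

lemma interleave_comp_params [simp]:
  "interleave c d \<circ> (\<lambda>i. 2 * i) = c" "interleave c d \<circ> (\<lambda>i. Suc (2 * i)) = d"
  by (simp_all add: comp_def)

text \<open>The odd coordinates carry the parameters.\<close>

definition definable_pred :: "('f, 'r, 'a) fo_structure \<Rightarrow> ((nat \<Rightarrow> 'a) \<Rightarrow> bool) \<Rightarrow> bool" where
  "definable_pred M \<Phi> \<longleftrightarrow> (\<exists>p c. wf_formula M p \<and> (\<forall>v. \<Phi> v \<longleftrightarrow> sat M (interleave v c) p))"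

lemma definable_pred_sat: "wf_formula M p \<Longrightarrow> definable_pred M (\<lambda>v. sat M v p)"
  unfolding definable_pred_def
  by (intro exI[of _ "rename (\<lambda>i. 2 * i) p"]) (simp add: wf_rename sat_rename comp_def)

text \<open>Simultaneous substitution: an even value of \<rho> names a variable of v, an odd one a
  constant from c.\<close>

lemma definable_pred_subst:
  assumes "definable_pred M \<Phi>"
  shows "definable_pred M (\<lambda>v. \<Phi> (interleave v c \<circ> \<rho>))"
proof -
  obtain p d where p: "wf_formula M p" "\<And>v. \<Phi> v \<longleftrightarrow> sat M (interleave v d) p"
    using assms unfolding definable_pred_def by blast
  \<comment> \<open>Three sources meet here: the variables of v at even places, the new constants c
    and the old parameters d in the even and odd halves of the new parameter tuple.\<close>
  define \<tau> where "\<tau> j = (if even j then (if even (\<rho> (j div 2)) then \<rho> (j div 2) else Suc (2 * (2 * (\<rho> (j div 2) div 2))))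
      else Suc (2 * Suc (2 * (j div 2))))" for j
  have "interleave (interleave v c \<circ> \<rho>) d = interleave v (interleave c d) \<circ> \<tau>" for v
  proof
    fix j
    show "interleave (interleave v c \<circ> \<rho>) d j = (interleave v (interleave c d) \<circ> \<tau>) j"
    proof (cases j rule: nat_even_odd_cases)
      case (even i)
      then show ?thesis
        by (cases "\<rho> i" rule: nat_even_odd_cases) (simp_all add: \<tau>_def)
    qed (simp add: \<tau>_def)
  qed
  then show ?thesis
    unfolding definable_pred_def
    by (intro exI[of _ "rename \<tau> p"] exI[of _ "interleave c d"])
      (simp add: wf_rename sat_rename p)
qed

lemma definable_pred_reindex:
  fixes M :: "('f, 'r, 'a) fo_structure"
  assumes "definable_pred M \<Phi>"
  shows "definable_pred M (\<lambda>v. \<Phi> (v \<circ> \<rho>))"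
proof -
  have "interleave v undefined \<circ> (\<lambda>i. 2 * \<rho> i) = v \<circ> \<rho>" for v :: "nat \<Rightarrow> 'a"
    by (simp add: comp_def)
  then show ?thesis using definable_pred_subst[OF assms, of undefined "\<lambda>i. 2 * \<rho> i"] by (simp only:)
qed

lemma definable_pred_neg:
  assumes "definable_pred M \<Phi>"
  shows "definable_pred M (\<lambda>v. \<not> \<Phi> v)"
proof -
  obtain p c where "wf_formula M p" "\<And>v. \<Phi> v \<longleftrightarrow> sat M (interleave v c) p"
    using assms unfolding definable_pred_def by blast
  then show ?thesis
    unfolding definable_pred_def by (intro exI[of _ "Neg p"] exI[of _ c]) simp
qed

lemma definable_pred_conj:
  assumes "definable_pred M \<Phi>" "definable_pred M \<Psi>"
  shows "definable_pred M (\<lambda>v. \<Phi> v \<and> \<Psi> v)"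
proof -
  obtain p c where p: "wf_formula M p" "\<And>v. \<Phi> v \<longleftrightarrow> sat M (interleave v c) p"
    using assms(1) unfolding definable_pred_def by blast
  obtain q d where q: "wf_formula M q" "\<And>v. \<Psi> v \<longleftrightarrow> sat M (interleave v d) q"
    using assms(2) unfolding definable_pred_def by blast
  let ?p = "rename (reindex_params (\<lambda>i. 2 * i)) p" and ?q = "rename (reindex_params (\<lambda>i. Suc (2 * i))) q"
  have "\<Phi> v \<and> \<Psi> v \<longleftrightarrow> sat M (interleave v (interleave c d)) (Conj ?p ?q)" for v
    by (simp add: sat_rename interleave_reindex_params p(2) q(2))
  moreover have "wf_formula M (Conj ?p ?q)"
    by (simp add: wf_rename p(1) q(1))
  ultimately show ?thesis
    unfolding definable_pred_def by blast
qed

lemma definable_pred_disj: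
  assumes "definable_pred M \<Phi>" "definable_pred M \<Psi>"
  shows "definable_pred M (\<lambda>v. \<Phi> v \<or> \<Psi> v)"
proof -
  have "definable_pred M (\<lambda>v. \<not> (\<not> \<Phi> v \<and> \<not> \<Psi> v))"
    by (intro definable_pred_neg definable_pred_conj assms)
  then show ?thesis by (simp only: de_Morgan_conj not_not)
qed

lemma definable_pred_imp:
  assumes "definable_pred M \<Phi>" "definable_pred M \<Psi>"
  shows "definable_pred M (\<lambda>v. \<Phi> v \<longrightarrow> \<Psi> v)"
  unfolding imp_conv_disj by (intro definable_pred_disj definable_pred_neg assms)

lemma definable_pred_ex:
  assumes "definable_pred M \<Phi>"
  shows "definable_pred M (\<lambda>v. \<exists>a. \<Phi> (v(k := a)))"
proof -
  obtain p c where p: "wf_formula M p" "\<And>v. \<Phi> v \<longleftrightarrow> sat M (interleave v c) p"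
    using assms unfolding definable_pred_def by blast
  have "interleave (v(k := a)) c = (interleave v c)(2 * k := a)" for v a
    by (auto simp: interleave_def fun_eq_iff)
  then show ?thesis
    unfolding definable_pred_def by (intro exI[of _ "Exists (2 * k) p"] exI[of _ c]) (simp add: p)
qed

lemma definable_pred_all:
  assumes "definable_pred M \<Phi>"
  shows "definable_pred M (\<lambda>v. \<forall>a. \<Phi> (v(k := a)))"
proof -
  have "definable_pred M (\<lambda>v. \<not> (\<exists>a. \<not> \<Phi> (v(k := a))))"
    by (intro definable_pred_neg definable_pred_ex[of M "\<lambda>v. \<not> \<Phi> v"] assms)
  then show ?thesis by (simp only: not_ex not_not)
qed

lemma definable_pred_true: "definable_pred M (\<lambda>v. True)"
  unfolding definable_pred_def by (intro exI[of _ "Equal (Var 0) (Var 0)"]) simp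

lemma definable_pred_ball:
  assumes "finite I" "\<And>i. i \<in> I \<Longrightarrow> definable_pred M (\<Phi> i)"
  shows "definable_pred M (\<lambda>v. \<forall>i\<in>I. \<Phi> i v)"
  using assms
proof (induction I rule: finite_induct)
  case (insert i I)
  then show ?case using definable_pred_conj[of M "\<Phi> i" "\<lambda>v. \<forall>i\<in>I. \<Phi> i v"] by simp
qed (simp add: definable_pred_true)

lemma definable_pred_ex_finite:
  assumes "finite I" "definable_pred M \<Phi>"
  shows "definable_pred M (\<lambda>v. \<exists>x. \<Phi> (\<lambda>i. if i \<in> I then x i else v i))"
  using assms
proof (induction I arbitrary: \<Phi> rule: finite_induct)
  case (insert k I)
  have "(\<exists>x. \<Phi> (\<lambda>i. if i \<in> insert k I then x i else v i))
      \<longleftrightarrow> (\<exists>a x. \<Phi> (\<lambda>i. if i \<in> I then x i else (v(k := a)) i))" (is "?L \<longleftrightarrow> ?R") for v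
  proof
    assume ?L
    then obtain x where "\<Phi> (\<lambda>i. if i \<in> insert k I then x i else v i)" ..
    moreover have "(\<lambda>i. if i \<in> insert k I then x i else v i)
        = (\<lambda>i. if i \<in> I then x i else (v(k := x k)) i)" by auto
    ultimately have "\<Phi> (\<lambda>i. if i \<in> I then x i else (v(k := x k)) i)" by simp
    then show ?R by blast
  next
    assume ?R
    then obtain a x where "\<Phi> (\<lambda>i. if i \<in> I then x i else (v(k := a)) i)" by blast
    moreover have "(\<lambda>i. if i \<in> I then x i else (v(k := a)) i)
        = (\<lambda>i. if i \<in> insert k I then (x(k := a)) i else v i)" using insert(2) by auto
    ultimately have "\<Phi> (\<lambda>i. if i \<in> insert k I then (x(k := a)) i else v i)" by simp
    then show ?L by blast
  qed
  then show ?case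
    using definable_pred_ex[OF insert.IH[OF insert.prems], of k] by simp
qed simp

text \<open>Quantifying over a whole valuation remains first-order because the formula mentions
  finitely many of its coordinates; the others are filled from c.\<close>

lemma definable_pred_ex_valuation:
  fixes M :: "('f, 'r, 'a) fo_structure"
  assumes "definable_pred M \<Phi>"
  shows "definable_pred M (\<lambda>u. \<exists>x. \<Phi> (interleave u x))"
proof -
  obtain p c where p: "wf_formula M p" "\<And>v. \<Phi> v \<longleftrightarrow> sat M (interleave v c) p"
    using assms unfolding definable_pred_def by blast
  define I where "I = (\<lambda>j. j div 2) ` free_vars p \<inter> {j. odd j}"
  have "finite I" by (simp add: I_def finite_free_vars)
  then have def: "definable_pred M (\<lambda>v. \<exists>x. \<Phi> (\<lambda>i. if i \<in> I then x i else v i))"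
    using assms by (rule definable_pred_ex_finite)
  have cong: "\<Phi> v \<longleftrightarrow> \<Phi> w" if "\<And>j. j \<in> (\<lambda>j. j div 2) ` free_vars p \<Longrightarrow> v j = w j" for v w
    unfolding p(2) by (rule sat_cong) (auto simp: interleave_def that)
  have "(\<exists>x. \<Phi> (\<lambda>i. if i \<in> I then x i else interleave u c i)) \<longleftrightarrow> (\<exists>x. \<Phi> (interleave u x))"
    (is "?L \<longleftrightarrow> ?R") for u
  proof
    assume ?L
    then obtain x where x: "\<Phi> (\<lambda>i. if i \<in> I then x i else interleave u c i)" by (elim exE)
    have "\<Phi> (interleave u (\<lambda>i. x (Suc (2 * i))))"
      by (rule cong[THEN iffD1, OF _ x]) (auto simp: I_def interleave_def)
    then show ?R by (rule exI[of "\<lambda>x. \<Phi> (interleave u x)"])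
  next
    assume ?R
    then obtain x where x: "\<Phi> (interleave u x)" by (elim exE)
    have "\<Phi> (\<lambda>i. if i \<in> I then interleave u x i else interleave u c i)"
      by (rule cong[THEN iffD1, OF _ x]) (auto simp: I_def interleave_def)
    then show ?L by (rule exI[of "\<lambda>x. \<Phi> (\<lambda>i. if i \<in> I then x i else interleave u c i)"])
  qed
  then show ?thesis using definable_pred_subst[OF def, of c id] unfolding comp_id by presburger
qed

section \<open>Definable sets, definable predicates and NIP\<close>

lemma definable_pred_of_definable:
  assumes "definable M n X"
  shows "definable_pred M (\<lambda>v. restrict v {..<n} \<in> X)"
proof -
  obtain p c where p: "wf_formula M p"
    and X: "X = {x \<in> cart_power n. sat M (\<lambda>i. if i < n then x i else c i) p}"
    using assms unfolding definable_def by blast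
  define \<rho> where "\<rho> i = (if i < n then 2 * i else Suc (2 * i))" for i
  have "interleave v c \<circ> \<rho> = (\<lambda>i. if i < n then restrict v {..<n} i else c i)" for v
    by (auto simp: fun_eq_iff \<rho>_def)
  then show ?thesis
    using definable_pred_subst[OF definable_pred_sat[OF p], of c \<rho>] by (simp add: X)
qed

lemma definable_line_of_definable_pred:
  fixes M :: "('f, 'r, 'a) fo_structure"
  assumes "definable_pred M \<Phi>"
  shows "definable_line M {a. \<Phi> (\<lambda>_. a)}"
proof -
  obtain p c where p: "wf_formula M p" "\<And>v. \<Phi> v \<longleftrightarrow> sat M (interleave v c) p"
    using assms unfolding definable_pred_def by blast
  \<comment> \<open>All object variables collapse to variable 0, and the parameters move up by one
    place behind it.\<close>
  define \<rho> where "\<rho> j = (if even j then 0 else Suc (j div 2))" for j :: nat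
  have "(\<lambda>i. if i < 1 then x i else c (i - 1)) \<circ> \<rho> = interleave (\<lambda>_. x 0) c" for x
    by (auto simp: fun_eq_iff \<rho>_def interleave_def)
  then have "sat M (\<lambda>i. if i < 1 then x i else c (i - 1)) (rename \<rho> p) \<longleftrightarrow> \<Phi> (\<lambda>_. x 0)" for x
    unfolding sat_rename p(2) by simp
  moreover have "(\<lambda>a. \<lambda>i\<in>{..<1}. a) ` {a. \<Phi> (\<lambda>_. a)} = {x \<in> cart_power 1. \<Phi> (\<lambda>_. x 0)}"
  proof (intro equalityI subsetI)
    fix x assume "x \<in> {x \<in> cart_power 1. \<Phi> (\<lambda>_. x 0)}"
    then have x: "x \<in> cart_power 1" "\<Phi> (\<lambda>_. x 0)" by auto
    then have "x = (\<lambda>i\<in>{..<1}. x 0)" by (auto simp: fun_eq_iff PiE_iff extensional_def)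
    with x(2) show "x \<in> (\<lambda>a. \<lambda>i\<in>{..<1}. a) ` {a. \<Phi> (\<lambda>_. a)}" by blast
  next
    have "(\<lambda>i\<in>{..<1}. a) \<in> cart_power 1" for a :: 'a
      unfolding restrict_PiE_iff by simp
    then show "x \<in> {x \<in> cart_power 1. \<Phi> (\<lambda>_. x 0)}"
      if "x \<in> (\<lambda>a. \<lambda>i\<in>{..<1}. a) ` {a. \<Phi> (\<lambda>_. a)}" for x
      using that by force
  qed
  ultimately show ?thesis
    unfolding definable_line_def definable_def
    by (intro exI[of _ "rename \<rho> p"] exI[of _ "\<lambda>i. c (i - 1)"]) (simp add: p(1) wf_rename)
qed

lemma definable_pred_of_definable_line:
  fixes M :: "('f, 'r, 'a) fo_structure"
  assumes "definable_line M X"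
  shows "definable_pred M (\<lambda>v. v i \<in> X)"
proof -
  have *: "restrict v {..<1} \<in> (\<lambda>a. \<lambda>i\<in>{..<1}. a) ` X \<longleftrightarrow> v 0 \<in> X" for v :: "nat \<Rightarrow> 'a"
    by (auto simp: fun_eq_iff restrict_def image_iff intro!: bexI[of _ "v 0"])
  have "definable_pred M (\<lambda>v. v 0 \<in> X)"
    using definable_pred_of_definable[OF assms[unfolded definable_line_def]] unfolding * .
  from definable_pred_reindex[OF this, of "\<lambda>_. i"] show ?thesis by simp
qed

text \<open>Fixed constants are counted among the parameter variables, and the choice of V decides
  whether v or w is the object tuple. One n thus bounds shattering on both sides, as
  \<open>bounded_cover\<close> requires.\<close>

lemma NIP_definable_pred:
  assumes "NIP M" "definable_pred M \<Phi>"
  obtains n where "\<not> shatters (\<lambda>v w. \<Phi> (interleave v w)) n"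
    "\<not> shatters (\<lambda>w v. \<Phi> (interleave v w)) n"
proof -
  obtain p c where p: "wf_formula M p" "\<And>v. \<Phi> v \<longleftrightarrow> sat M (interleave v c) p"
    using assms(2) unfolding definable_pred_def by blast
  \<comment> \<open>The places in V are read from v and all others from w or c. Since w appears in
    both halves of \<open>interleave w w\<close>, the same expression serves both choices of V
    below.\<close>
  have bounded: "\<exists>n. \<not> shatters E n"
    if E: "\<And>v w. E v w \<longleftrightarrow>
      sat M (\<lambda>j. if j \<in> V then v (j div 2 div 2) else interleave (interleave w w) c j) p" for E V
  proof (rule ccontr)
    assume "\<not> ?thesis"
    then have ind: "shatters E n" for n :: nat by simp
    have "independence_property M V p"
      unfolding independence_property_def
    proof
      fix n :: nat
      obtain a b where ab: "\<forall>i<n. \<forall>S\<subseteq>{..<n}. E (a i) (b S) \<longleftrightarrow> i \<in> S"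
        using ind[of n] unfolding shatters_def by (elim exE)
      then show "\<exists>a b. \<forall>i<n. \<forall>S\<subseteq>{..<n}. sat M (\<lambda>j. if j \<in> V then a i j else b S j) p \<longleftrightarrow> i \<in> S"
        unfolding E
        by (intro exI[of _ "\<lambda>i j. a i (j div 2 div 2)"]
            exI[of _ "\<lambda>S. interleave (interleave (b S) (b S)) c"]) simp
    qed
    with assms(1) p(1) show False unfolding NIP_def by blast
  qed
  have "\<exists>n. \<not> shatters (\<lambda>v w. \<Phi> (interleave v w)) n"
  proof (rule bounded[of _ "{j. even j \<and> even (j div 2)}"])
    fix v w
    have "interleave (interleave v w) c = (\<lambda>j. if j \<in> {j. even j \<and> even (j div 2)}
        then v (j div 2 div 2) else interleave (interleave w w) c j)"
      by (auto simp: fun_eq_iff interleave_def)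
    then show "\<Phi> (interleave v w) \<longleftrightarrow> sat M (\<lambda>j. if j \<in> {j. even j \<and> even (j div 2)}
        then v (j div 2 div 2) else interleave (interleave w w) c j) p"
      unfolding p(2) by (rule arg_cong)
  qed
  moreover have "\<exists>n. \<not> shatters (\<lambda>w v. \<Phi> (interleave v w)) n"
  proof (rule bounded[of _ "{j. even j \<and> odd (j div 2)}"])
    fix v w
    have "interleave (interleave w v) c = (\<lambda>j. if j \<in> {j. even j \<and> odd (j div 2)}
        then v (j div 2 div 2) else interleave (interleave w w) c j)"
      by (auto simp: fun_eq_iff interleave_def)
    then show "\<Phi> (interleave w v) \<longleftrightarrow> sat M (\<lambda>j. if j \<in> {j. even j \<and> odd (j div 2)}
        then v (j div 2 div 2) else interleave (interleave w w) c j) p"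
      unfolding p(2) by (rule arg_cong)
  qed
  ultimately obtain n m where "\<not> shatters (\<lambda>v w. \<Phi> (interleave v w)) n"
    "\<not> shatters (\<lambda>w v. \<Phi> (interleave v w)) m" by blast
  then show thesis using that[of "max n m"] shatters_mono by (metis max.cobounded1 max.cobounded2)
qed

section \<open>Traceable predicates\<close>

lemma eventually_nhds_compose:
  assumes "continuous_on UNIV h" "\<forall>\<^sub>F y in nhds (h x). P y"
  shows "\<forall>\<^sub>F x in nhds x. P (h x)"
proof -
  obtain S where "open S" "h x \<in> S" "\<And>y. y \<in> S \<Longrightarrow> P y"
    using assms(2) unfolding eventually_nhds by blast
  moreover from this have "open (h -` S)" using assms(1) by (simp add: open_vimage)
  ultimately show ?thesis unfolding eventually_nhds by (intro exI[of _ "h -` S"]) auto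
qed

text \<open>Nonstandardly: the set of points of an elementary extension that are infinitely close to a
  real valuation satisfying \<open>P\<close> is externally definable.\<close>

definition traceable :: "('f, 'r, real) fo_structure \<Rightarrow> ((nat \<Rightarrow> real) \<Rightarrow> bool) \<Rightarrow> bool" where
  "traceable M P \<longleftrightarrow> (\<exists>\<Phi>. definable_pred M \<Phi> \<and>
     (\<forall>F G. finite F \<longrightarrow> finite G \<longrightarrow> (\<forall>f\<in>F. P f) \<longrightarrow> (\<forall>g\<in>G. \<not> P g) \<longrightarrow>
       (\<exists>w. (\<forall>f\<in>F. \<forall>\<^sub>F v in nhds f. \<Phi> (interleave v w)) \<and>
            (\<forall>g\<in>G. \<forall>\<^sub>F v in nhds g. \<not> \<Phi> (interleave v w)))))"

lemma traceableI:
  assumes "definable_pred M \<Phi>"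
    and "\<And>F G. finite F \<Longrightarrow> finite G \<Longrightarrow> (\<And>f. f \<in> F \<Longrightarrow> P f) \<Longrightarrow> (\<And>g. g \<in> G \<Longrightarrow> \<not> P g) \<Longrightarrow>
      \<exists>w. (\<forall>f\<in>F. \<forall>\<^sub>F v in nhds f. \<Phi> (interleave v w)) \<and>
          (\<forall>g\<in>G. \<forall>\<^sub>F v in nhds g. \<not> \<Phi> (interleave v w))"
  shows "traceable M P"
  unfolding traceable_def using assms by (intro exI[of _ \<Phi>] conjI allI impI) blast+

lemma traceableE:
  assumes "traceable M P"
  obtains \<Phi> where "definable_pred M \<Phi>"
    and "\<And>F G. finite F \<Longrightarrow> finite G \<Longrightarrow> (\<And>f. f \<in> F \<Longrightarrow> P f) \<Longrightarrow> (\<And>g. g \<in> G \<Longrightarrow> \<not> P g) \<Longrightarrow>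
      \<exists>w. (\<forall>f\<in>F. \<forall>\<^sub>F v in nhds f. \<Phi> (interleave v w)) \<and>
          (\<forall>g\<in>G. \<forall>\<^sub>F v in nhds g. \<not> \<Phi> (interleave v w))"
proof -
  obtain \<Phi> where "definable_pred M \<Phi>"
    "\<forall>F G. finite F \<longrightarrow> finite G \<longrightarrow> (\<forall>f\<in>F. P f) \<longrightarrow> (\<forall>g\<in>G. \<not> P g) \<longrightarrow>
       (\<exists>w. (\<forall>f\<in>F. \<forall>\<^sub>F v in nhds f. \<Phi> (interleave v w)) \<and>
            (\<forall>g\<in>G. \<forall>\<^sub>F v in nhds g. \<not> \<Phi> (interleave v w)))"
    using assms unfolding traceable_def by (elim exE conjE)
  then show thesis by (intro that[of \<Phi>]) simp_all
qed

lemma traceable_neg: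
  assumes "traceable M P"
  shows "traceable M (\<lambda>v. \<not> P v)"
proof -
  obtain \<Phi> where \<Phi>: "definable_pred M \<Phi>"
    "\<And>F G. finite F \<Longrightarrow> finite G \<Longrightarrow> (\<And>f. f \<in> F \<Longrightarrow> P f) \<Longrightarrow> (\<And>g. g \<in> G \<Longrightarrow> \<not> P g) \<Longrightarrow>
      \<exists>w. (\<forall>f\<in>F. \<forall>\<^sub>F v in nhds f. \<Phi> (interleave v w)) \<and>
          (\<forall>g\<in>G. \<forall>\<^sub>F v in nhds g. \<not> \<Phi> (interleave v w))"
    using traceableE[OF assms] by blast
  show ?thesis
  proof (rule traceableI[OF definable_pred_neg[OF \<Phi>(1)]])
    fix F G assume FG: "finite F" "finite G" "\<And>f. f \<in> F \<Longrightarrow> \<not> P f" "\<And>g. g \<in> G \<Longrightarrow> \<not> \<not> P g"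
    then obtain w where "\<forall>f\<in>G. \<forall>\<^sub>F v in nhds f. \<Phi> (interleave v w)"
      "\<forall>f\<in>F. \<forall>\<^sub>F v in nhds f. \<not> \<Phi> (interleave v w)"
      using \<Phi>(2)[of G F] by auto
    then show "\<exists>w. (\<forall>f\<in>F. \<forall>\<^sub>F v in nhds f. \<not> \<Phi> (interleave v w)) \<and>
        (\<forall>g\<in>G. \<forall>\<^sub>F v in nhds g. \<not> \<not> \<Phi> (interleave v w))"
      by (intro exI[of _ w]) simp
  qed
qed

text \<open>One tuple carries the parameters of both families in its even and odd coordinates. Each
  point of G is rejected by a conjunct that fails there.\<close>

lemma traceable_conj:
  assumes "traceable M P" "traceable M Q"
  shows "traceable M (\<lambda>v. P v \<and> Q v)"
proof -
  obtain \<Phi> where \<Phi>: "definable_pred M \<Phi>"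
    "\<And>F G. finite F \<Longrightarrow> finite G \<Longrightarrow> (\<And>f. f \<in> F \<Longrightarrow> P f) \<Longrightarrow> (\<And>g. g \<in> G \<Longrightarrow> \<not> P g) \<Longrightarrow>
      \<exists>w. (\<forall>f\<in>F. \<forall>\<^sub>F v in nhds f. \<Phi> (interleave v w)) \<and>
          (\<forall>g\<in>G. \<forall>\<^sub>F v in nhds g. \<not> \<Phi> (interleave v w))"
    using traceableE[OF assms(1)] by blast
  obtain \<Psi> where \<Psi>: "definable_pred M \<Psi>"
    "\<And>F G. finite F \<Longrightarrow> finite G \<Longrightarrow> (\<And>f. f \<in> F \<Longrightarrow> Q f) \<Longrightarrow> (\<And>g. g \<in> G \<Longrightarrow> \<not> Q g) \<Longrightarrow>
      \<exists>w. (\<forall>f\<in>F. \<forall>\<^sub>F v in nhds f. \<Psi> (interleave v w)) \<and>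
          (\<forall>g\<in>G. \<forall>\<^sub>F v in nhds g. \<not> \<Psi> (interleave v w))"
    using traceableE[OF assms(2)] by blast
  define \<Theta> where "\<Theta> u \<longleftrightarrow> \<Phi> (u \<circ> reindex_params (\<lambda>i. 2 * i)) \<and> \<Psi> (u \<circ> reindex_params (\<lambda>i. Suc (2 * i)))" for u
  have \<Theta>: "\<Theta> (interleave v (interleave c d)) \<longleftrightarrow> \<Phi> (interleave v c) \<and> \<Psi> (interleave v d)" for v c d
    by (simp add: \<Theta>_def interleave_reindex_params)
  show ?thesis
  proof (rule traceableI[of M \<Theta>])
    show "definable_pred M \<Theta>"
      unfolding \<Theta>_def by (intro definable_pred_conj definable_pred_reindex \<Phi>(1) \<Psi>(1))
    fix F G assume FG: "finite F" "finite G" "\<And>f. f \<in> F \<Longrightarrow> P f \<and> Q f" "\<And>g. g \<in> G \<Longrightarrow> \<not> (P g \<and> Q g)"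
    have "\<exists>w. (\<forall>f\<in>F. \<forall>\<^sub>F v in nhds f. \<Phi> (interleave v w)) \<and>
        (\<forall>g\<in>{g \<in> G. \<not> P g}. \<forall>\<^sub>F v in nhds g. \<not> \<Phi> (interleave v w))"
      by (rule \<Phi>(2)) (use FG in auto)
    then obtain c where "(\<forall>f\<in>F. \<forall>\<^sub>F v in nhds f. \<Phi> (interleave v c)) \<and>
        (\<forall>g\<in>{g \<in> G. \<not> P g}. \<forall>\<^sub>F v in nhds g. \<not> \<Phi> (interleave v c))"
      by (elim exE)
    then have c: "\<And>f. f \<in> F \<Longrightarrow> \<forall>\<^sub>F v in nhds f. \<Phi> (interleave v c)"
      "\<And>g. g \<in> G \<Longrightarrow> \<not> P g \<Longrightarrow> \<forall>\<^sub>F v in nhds g. \<not> \<Phi> (interleave v c)"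
      by simp_all
    have "\<exists>w. (\<forall>f\<in>F. \<forall>\<^sub>F v in nhds f. \<Psi> (interleave v w)) \<and>
        (\<forall>g\<in>{g \<in> G. \<not> Q g}. \<forall>\<^sub>F v in nhds g. \<not> \<Psi> (interleave v w))"
      by (rule \<Psi>(2)) (use FG in auto)
    then obtain d where "(\<forall>f\<in>F. \<forall>\<^sub>F v in nhds f. \<Psi> (interleave v d)) \<and>
        (\<forall>g\<in>{g \<in> G. \<not> Q g}. \<forall>\<^sub>F v in nhds g. \<not> \<Psi> (interleave v d))"
      by (elim exE)
    then have d: "\<And>f. f \<in> F \<Longrightarrow> \<forall>\<^sub>F v in nhds f. \<Psi> (interleave v d)"
      "\<And>g. g \<in> G \<Longrightarrow> \<not> Q g \<Longrightarrow> \<forall>\<^sub>F v in nhds g. \<not> \<Psi> (interleave v d)"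
      by simp_all
    show "\<exists>w. (\<forall>f\<in>F. \<forall>\<^sub>F v in nhds f. \<Theta> (interleave v w)) \<and>
        (\<forall>g\<in>G. \<forall>\<^sub>F v in nhds g. \<not> \<Theta> (interleave v w))"
    proof (intro exI[of _ "interleave c d"] conjI ballI)
      fix f assume "f \<in> F"
      then show "\<forall>\<^sub>F v in nhds f. \<Theta> (interleave v (interleave c d))"
        unfolding \<Theta> using c d by (intro eventually_conj)
    next
      fix g assume g: "g \<in> G"
      then consider "\<not> P g" | "\<not> Q g" using FG by blast
      then show "\<forall>\<^sub>F v in nhds g. \<not> \<Theta> (interleave v (interleave c d))"
      proof cases
        case 1
        show ?thesis unfolding \<Theta> using c(2)[OF g 1] by (rule eventually_mono) simp
      next
        case 2
        show ?thesis unfolding \<Theta> using d(2)[OF g 2] by (rule eventually_mono) simp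
      qed
    qed
  qed
qed

section \<open>Projections of traceable predicates\<close>

text \<open>In effect the compact set of k-tuples from K is covered by products of neighbourhoods,
  one coordinate at a time. The conclusion is about an open U around K because the formula has to be
  refuted on a neighbourhood, not only at the given points.\<close>

lemma compact_finite_family:
  fixes K :: "'v :: topological_space set" and E :: "'v \<Rightarrow> 'w \<Rightarrow> bool"
  assumes "compact K"
    and E: "\<And>H. finite H \<Longrightarrow> H \<subseteq> K \<Longrightarrow> \<exists>w\<in>B. \<forall>h\<in>H. \<forall>\<^sub>F v in nhds h. E v w"
  shows "\<exists>B' U. finite B' \<and> B' \<subseteq> B \<and> open U \<and> K \<subseteq> U \<and>
    (\<forall>Y\<subseteq>U. finite Y \<and> card Y \<le> k \<longrightarrow> (\<exists>w\<in>B'. \<forall>v\<in>Y. E v w))"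
proof -
  \<comment> \<open>For the induction, keep a neighbourhood \<open>N\<close> of finitely many additional points.\<close>
  define good where "good k B' U N \<longleftrightarrow> finite B' \<and> B' \<subseteq> B \<and> open U \<and> K \<subseteq> U \<and> open N \<and>
    (\<forall>Y\<subseteq>U. finite Y \<and> card Y \<le> k \<longrightarrow> (\<exists>w\<in>B'. \<forall>v\<in>N \<union> Y. E v w))" for k B' U N
  have "\<exists>B' U N. good k B' U N \<and> H \<subseteq> N" if "finite H" "H \<subseteq> K" for H
    using that
  proof (induction k arbitrary: H)
    case 0
    then obtain w where w: "w \<in> B" "\<forall>h\<in>H. \<forall>\<^sub>F v in nhds h. E v w" using E by blast
    let ?N = "interior {v. E v w}"
    have "H \<subseteq> ?N"
      using w(2) unfolding eventually_nhds by (force simp: interior_def)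
    moreover have "good 0 {w} UNIV ?N"
      unfolding good_def using w(1) interior_subset[of "{v. E v w}"] by auto
    ultimately show ?case by blast
  next
    case (Suc k)
    have "\<forall>h\<in>K. \<exists>B' U N. good k B' U N \<and> insert h H \<subseteq> N"
      by (intro ballI Suc.IH) (use Suc.prems in auto)
    then obtain B' U N where g: "\<And>h. h \<in> K \<Longrightarrow> good k (B' h) (U h) (N h)" "\<And>h. h \<in> K \<Longrightarrow> insert h H \<subseteq> N h"
      by metis
    \<comment> \<open>Handles the sets Y of at most k points; if K is empty, no others
      remain.\<close>
    obtain B0 U0 N0 where g0: "good k B0 U0 N0" "H \<subseteq> N0" using Suc.IH[OF Suc.prems] by (elim exE conjE)
    have "open (N h)" if "h \<in> K" for h using g(1)[OF that] by (simp add: good_def)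
    moreover have "K \<subseteq> (\<Union>h\<in>K. N h)" using g(2) by auto
    ultimately obtain D where D: "D \<subseteq> K" "finite D" "K \<subseteq> (\<Union>h\<in>D. N h)"
      by (rule compactE_image[OF \<open>compact K\<close>, of K N])
    have gD: "good k (B' h) (U h) (N h)" if "h \<in> D" for h using g(1) D(1) that by blast
    define B1 where "B1 = B0 \<union> (\<Union>h\<in>D. B' h)"
    \<comment> \<open>Among \<open>Suc k\<close> points of U1, one lies in some \<open>N h\<close>,
      where it is protected together with h. The other k points lie in \<open>U h\<close> and are
      handled by \<open>B' h\<close>.\<close>
    define U1 where "U1 = U0 \<inter> (\<Inter>h\<in>D. U h) \<inter> (\<Union>h\<in>D. N h)"
    define N1 where "N1 = N0 \<inter> (\<Inter>h\<in>D. N h)"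
    have "good (Suc k) B1 U1 N1"
      unfolding good_def
    proof (intro conjI allI impI)
      show "finite B1" using gD g0(1) D(2) by (simp add: B1_def good_def)
      show "B1 \<subseteq> B" using gD g0(1) by (simp add: B1_def good_def UN_least)
      show "K \<subseteq> U1" using gD g0(1) D(3) by (simp add: U1_def good_def INT_greatest)
      show "open U1" using gD g0(1) D(2) by (simp add: U1_def good_def open_Int open_INT open_UN)
      show "open N1" using gD g0(1) D(2) by (simp add: N1_def good_def open_Int open_INT)
      fix Y assume Y: "Y \<subseteq> U1" "finite Y \<and> card Y \<le> Suc k"
      show "\<exists>w\<in>B1. \<forall>v\<in>N1 \<union> Y. E v w"
      proof (cases "card Y \<le> k")
        case True
        moreover have "Y \<subseteq> U0" using Y by (auto simp: U1_def)
        ultimately obtain w where "w \<in> B0" "\<forall>v\<in>N0 \<union> Y. E v w"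
          using g0(1) Y(2) unfolding good_def by blast
        then show ?thesis by (intro bexI[of _ w]) (auto simp: B1_def N1_def)
      next
        case False
        then obtain y where y: "y \<in> Y" by fastforce
        then obtain h where h: "h \<in> D" "y \<in> N h" using Y(1) by (auto simp: U1_def)
        have "card (Y - {y}) \<le> k" "finite (Y - {y})" using Y(2) y by auto
        moreover have "Y - {y} \<subseteq> U h" using Y(1) h(1) by (auto simp: U1_def)
        ultimately obtain w where "w \<in> B' h" "\<forall>v\<in>N h \<union> (Y - {y}). E v w"
          using gD[OF h(1)] unfolding good_def by blast
        then show ?thesis using h by (intro bexI[of _ w]) (auto simp: B1_def N1_def)
      qed
    qed
    moreover have "H \<subseteq> N1" using g(2) g0(2) D(1) by (auto simp: N1_def)
    ultimately show ?case by blast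
  qed
  from this[of "{}"] obtain B' U N where "good k B' U N" by auto
  then have B': "finite B'" "B' \<subseteq> B" "open U" "K \<subseteq> U"
    and w: "\<And>Y. Y \<subseteq> U \<Longrightarrow> finite Y \<and> card Y \<le> k \<Longrightarrow> \<exists>w\<in>B'. \<forall>v\<in>N \<union> Y. E v w"
    unfolding good_def by simp_all
  have "\<exists>w\<in>B'. \<forall>v\<in>Y. E v w" if "Y \<subseteq> U" "finite Y \<and> card Y \<le> k" for Y
    using w[OF that] by (elim bexE) (intro bexI, auto)
  with B' show ?thesis by (intro exI[of _ B'] exI[of _ U]) simp
qed

lemma continuous_on_fun_upd_pair:
  "continuous_on UNIV (\<lambda>(v :: 'i \<Rightarrow> 'a :: topological_space, a). v(k := a))"
proof (rule continuous_on_coordinatewise_then_product)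
  fix i
  have "continuous_on UNIV (\<lambda>p :: ('i \<Rightarrow> 'a) \<times> 'a. fst p i)"
    by (rule continuous_on_compose2[OF continuous_on_product_coordinates]) (auto intro: continuous_intros)
  moreover have "continuous_on UNIV (\<lambda>p :: ('i \<Rightarrow> 'a) \<times> 'a. snd p)"
    by (intro continuous_intros)
  ultimately show "continuous_on UNIV (\<lambda>p. (case p of (v :: 'i \<Rightarrow> 'a, a) \<Rightarrow> v(k := a)) i)"
    by (cases "i = k") (simp_all add: case_prod_unfold)
qed

lemma definable_pred_less:
  assumes "definable_pred M (\<lambda>v. v 0 < v 1)"
  shows "definable_pred M (\<lambda>v. v i < v j)"
  using definable_pred_reindex[OF assms, of "\<lambda>k. if k = 0 then i else j"] by simp

text \<open>If g has no witness, \<Phi> must be refuted on a whole segment over g. In terms of its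
  complement E, finitely many parameters have to cover that segment, and their number must be
  bounded before F and G are given, since all of them enter \<Theta>. \<open>bounded_cover\<close>
  supplies the bound. Every parameter used comes from B, so the conjunction still holds near the
  chosen lifts of F.\<close>

lemma traceable_ex:
  fixes M :: "('f, 'r, real) fo_structure"
  assumes nip: "NIP M" and less: "definable_pred M (\<lambda>v. v 0 < v 1)" and P: "traceable M P"
  shows "traceable M (\<lambda>v. \<exists>a. P (v(\<kappa> := a)))"
proof -
  obtain \<Phi> where def: "definable_pred M \<Phi>" and
    tr: "\<And>F G. finite F \<Longrightarrow> finite G \<Longrightarrow> (\<And>f. f \<in> F \<Longrightarrow> P f) \<Longrightarrow> (\<And>g. g \<in> G \<Longrightarrow> \<not> P g) \<Longrightarrow>
      \<exists>w. (\<forall>f\<in>F. \<forall>\<^sub>F v in nhds f. \<Phi> (interleave v w)) \<and>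
          (\<forall>g\<in>G. \<forall>\<^sub>F v in nhds g. \<not> \<Phi> (interleave v w))"
    using traceableE[OF P] by blast
  define E where "E v w \<longleftrightarrow> \<not> \<Phi> (interleave v w)" for v w
  obtain n where "\<not> shatters (\<lambda>v w. \<Phi> (interleave v w)) n" "\<not> shatters (\<lambda>w v. \<Phi> (interleave v w)) n"
    using NIP_definable_pred[OF nip def] by blast
  then have vc: "\<not> shatters E n" "\<not> shatters (\<lambda>w v. E v w) n"
    using shatters_neg[of "\<lambda>v w. \<Phi> (interleave v w)" n]
      shatters_neg[of "\<lambda>w v. \<Phi> (interleave v w)" n] unfolding E_def by blast+
  obtain k m where cover: "\<And>(E :: (nat \<Rightarrow> real) \<Rightarrow> (nat \<Rightarrow> real) \<Rightarrow> bool) U B. finite B \<Longrightarrow> \<not> shatters E n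
      \<Longrightarrow> \<not> shatters (\<lambda>b p. E p b) n
      \<Longrightarrow> (\<And>Q. Q \<subseteq> U \<Longrightarrow> finite Q \<Longrightarrow> card Q \<le> k \<Longrightarrow> \<exists>b\<in>B. \<forall>p\<in>Q. E p b)
      \<Longrightarrow> \<exists>C\<subseteq>B. finite C \<and> card C \<le> m \<and> (\<forall>p\<in>U. \<exists>b\<in>C. E p b)"
    using bounded_cover[where ?'p = "nat \<Rightarrow> real" and ?'b = "nat \<Rightarrow> real"] by blast
  \<comment> \<open>Parameters 0 and 1 are the ends of the segment. From 2 on, residues modulo
    \<open>Suc m\<close> split the coordinates into \<open>Suc m\<close> independent tuples.\<close>
  define code where "code j i = 2 + i * Suc m + j" for i j
  \<comment> \<open>\<open>u 1\<close> and \<open>u 3\<close> are the parameters 0 and 1, and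
    \<open>u (2 * \<kappa>)\<close> is the witness.\<close>
  define \<Psi> where "\<Psi> u \<longleftrightarrow> \<not> u (2 * \<kappa>) < u 1 \<and> \<not> u 3 < u (2 * \<kappa>) \<and>
      (\<forall>j\<in>{..m}. \<Phi> (u \<circ> reindex_params (code j)))" for u :: "nat \<Rightarrow> real"
  define \<Theta> where "\<Theta> u \<longleftrightarrow> (\<exists>a. \<Psi> (u(2 * \<kappa> := a)))" for u
  have upd: "(interleave v w)(2 * \<kappa> := a) = interleave (v(\<kappa> := a)) w" for v w and a :: real
    by (auto simp: interleave_def fun_eq_iff)
  have \<Theta>: "\<Theta> (interleave v w) \<longleftrightarrow>
      (\<exists>a. w 0 \<le> a \<and> a \<le> w 1 \<and> (\<forall>j\<le>m. \<Phi> (interleave (v(\<kappa> := a)) (w \<circ> code j))))" for v w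
  proof -
    have "interleave u w 1 = w 0" "interleave u w 3 = w 1" for u
      by (simp_all add: interleave_def)
    then show ?thesis
      by (simp only: \<Theta>_def \<Psi>_def upd interleave_reindex_params interleave_even fun_upd_same
          not_less Ball_def atMost_iff)
  qed
  show ?thesis
  proof (rule traceableI[of M \<Theta>])
    show "definable_pred M \<Theta>"
      unfolding \<Theta>_def \<Psi>_def
      by (intro definable_pred_ex[of M \<Psi>, unfolded \<Psi>_def] definable_pred_conj definable_pred_neg
          definable_pred_less[OF less] definable_pred_ball definable_pred_reindex[OF def]) simp
    fix F G assume FG: "finite F" "finite G" "\<And>f. f \<in> F \<Longrightarrow> \<exists>a. P (f(\<kappa> := a))"
      "\<And>g. g \<in> G \<Longrightarrow> \<not> (\<exists>a. P (g(\<kappa> := a)))"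
    obtain a where a: "\<And>f. f \<in> F \<Longrightarrow> P (f(\<kappa> := a f))" using FG(3) by metis
    obtain l r where lr: "\<And>f. f \<in> F \<Longrightarrow> l \<le> a f \<and> a f \<le> r"
    proof -
      have "bdd_below (a ` F)" "bdd_above (a ` F)" using FG(1) by simp_all
      then show thesis using that unfolding bdd_below_def bdd_above_def by blast
    qed
    define K where "K = (\<lambda>(v, a). v(\<kappa> := a)) ` (G \<times> {l..r})"
    have "compact K"
      unfolding K_def
      by (intro compact_continuous_image compact_Times finite_imp_compact FG(2) compact_Icc
          continuous_on_subset[OF continuous_on_fun_upd_pair]) simp
    define B where "B = {w. \<forall>f\<in>F. \<forall>\<^sub>F v in nhds (f(\<kappa> := a f)). \<Phi> (interleave v w)}"
    have small: "\<exists>w\<in>B. \<forall>h\<in>H. \<forall>\<^sub>F v in nhds h. E v w" if "finite H" "H \<subseteq> K" for H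
    proof -
      have "\<not> P h" if "h \<in> H" for h using that \<open>H \<subseteq> K\<close> FG(4) by (auto simp: K_def)
      then have "\<exists>w. (\<forall>f\<in>(\<lambda>f. f(\<kappa> := a f)) ` F. \<forall>\<^sub>F v in nhds f. \<Phi> (interleave v w)) \<and>
          (\<forall>g\<in>H. \<forall>\<^sub>F v in nhds g. \<not> \<Phi> (interleave v w))"
        by (intro tr) (use FG(1) \<open>finite H\<close> a in auto)
      then show ?thesis unfolding B_def E_def by auto
    qed
    obtain B' U where B': "finite B'" "B' \<subseteq> B" "open U" "K \<subseteq> U"
      and U: "\<And>Y. Y \<subseteq> U \<Longrightarrow> finite Y \<Longrightarrow> card Y \<le> k \<Longrightarrow> \<exists>w\<in>B'. \<forall>v\<in>Y. E v w"
      using compact_finite_family[of K B E k, OF \<open>compact K\<close> small] by metis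
    obtain C where C: "C \<subseteq> B'" "finite C" "card C \<le> m" "\<forall>v\<in>U. \<exists>w\<in>C. E v w"
      using cover[of B' E U, OF B'(1) vc U] by auto
    \<comment> \<open>Pads the list of tuples to length \<open>Suc m\<close>, also when C is empty.
      Any member of B is true near the lifts.\<close>
    obtain w0 where w0: "w0 \<in> B" using small[of "{}"] by auto
    obtain ws where ws: "ws ` {..m} = insert w0 C"
    proof -
      let ?S = "insert w0 C"
      have card: "card ?S \<le> Suc m" using C(2,3) by (simp add: card_insert_if)
      obtain h where h: "bij_betw h {0..<card ?S} ?S"
        using ex_bij_betw_nat_finite[of ?S] C(2) by auto
      let ?f = "\<lambda>i. if i < card ?S then h i else w0"
      have "?f i \<in> ?S" for i using h by (auto simp: bij_betw_def)
      moreover have "\<exists>i\<le>m. s = ?f i" if "s \<in> ?S" for s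
      proof -
        obtain i where "i < card ?S" "s = h i"
          using h \<open>s \<in> ?S\<close> unfolding bij_betw_def by (metis atLeastLessThan_iff imageE)
        then show ?thesis using card by (intro exI[of _ i]) simp
      qed
      ultimately have "?f ` {..m} = ?S" by blast
      then show thesis by (rule that)
    qed
    define w where "w i = (if i = 0 then l else if i = 1 then r
      else ws ((i - 2) mod Suc m) ((i - 2) div Suc m))" for i
    have w: "w 0 = l" "w 1 = r" by (simp_all add: w_def)
    have wc: "w \<circ> code j = ws j" if "j \<le> m" for j
    proof
      fix i
      have "(i * Suc m + j) mod Suc m = j" "(i * Suc m + j) div Suc m = i"
        using that by (simp_all only: mod_mult_self3 div_mult_self3 Suc_not_Zero not_False_eq_True
            mod_less div_less le_imp_less_Suc add_0_right)
      moreover have "w (code j i) = ws ((i * Suc m + j) mod Suc m) ((i * Suc m + j) div Suc m)"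
        unfolding w_def code_def by (simp only: add.assoc) simp
      ultimately show "(w \<circ> code j) i = ws j i" by simp
    qed
    have \<Theta>w: "\<Theta> (interleave v w) \<longleftrightarrow> (\<exists>a. l \<le> a \<and> a \<le> r \<and> (\<forall>j\<le>m. \<Phi> (interleave (v(\<kappa> := a)) (ws j))))" for v
      unfolding \<Theta> w by (simp add: wc)
    show "\<exists>w. (\<forall>f\<in>F. \<forall>\<^sub>F v in nhds f. \<Theta> (interleave v w)) \<and>
        (\<forall>g\<in>G. \<forall>\<^sub>F v in nhds g. \<not> \<Theta> (interleave v w))"
    proof (intro exI[of _ w] conjI ballI)
      fix f assume f: "f \<in> F"
      have cont: "continuous_on UNIV (\<lambda>v :: nat \<Rightarrow> real. v(\<kappa> := a f))"
        using continuous_on_compose2[OF continuous_on_fun_upd_pair, of UNIV "\<lambda>v. (v, a f)" \<kappa>]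
        by (simp add: continuous_on_Pair)
      have "\<forall>\<^sub>F v in nhds f. \<Phi> (interleave (v(\<kappa> := a f)) (ws j))" if "j \<in> {..m}" for j
      proof -
        have "ws j \<in> insert w0 C" unfolding ws[symmetric] using that by (rule imageI)
        then have "ws j \<in> B" using C(1) B'(2) w0 by auto
        then have "\<forall>\<^sub>F v in nhds (f(\<kappa> := a f)). \<Phi> (interleave v (ws j))" using f by (simp add: B_def)
        with cont show ?thesis by (rule eventually_nhds_compose[where x = f])
      qed
      then have "\<forall>\<^sub>F v in nhds f. \<forall>j\<in>{..m}. \<Phi> (interleave (v(\<kappa> := a f)) (ws j))"
        by (intro eventually_ball_finite) auto
      then show "\<forall>\<^sub>F v in nhds f. \<Theta> (interleave v w)"
        by (rule eventually_mono) (use lr[OF f] in \<open>auto simp: \<Theta>w intro!: exI[of _ "a f"]\<close>)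
    next
      fix g assume g: "g \<in> G"
      \<comment> \<open>By the tube lemma one neighbourhood of g works for all a in the compact
        interval at once.\<close>
      let ?W = "(\<lambda>(v, a). v(\<kappa> := a)) -` U"
      have "open ?W" using B'(3) by (intro open_vimage continuous_on_fun_upd_pair)
      moreover have "{g} \<times> {l..r} \<subseteq> ?W" using B'(4) g by (auto simp: K_def)
      ultimately have "\<exists>X. g \<in> X \<and> open X \<and> X \<times> {l..r} \<subseteq> ?W"
        by (rule Elementary_Topology.tube_lemma[OF compact_Icc])
      then obtain X where X: "g \<in> X" "open X" "X \<times> {l..r} \<subseteq> ?W" by (elim exE conjE)
      have "\<not> \<Theta> (interleave v w)" if "v \<in> X" for v
      proof
        assume "\<Theta> (interleave v w)"
        then obtain a where a: "l \<le> a" "a \<le> r" "\<And>j. j \<le> m \<Longrightarrow> \<Phi> (interleave (v(\<kappa> := a)) (ws j))"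
          by (auto simp: \<Theta>w)
        then have "(v, a) \<in> ?W" using X(3) \<open>v \<in> X\<close> by (intro subsetD[OF X(3)]) simp
        then have "v(\<kappa> := a) \<in> U" by simp
        then obtain b where "b \<in> C" "E (v(\<kappa> := a)) b" using C(4) by blast
        moreover from this obtain j where "j \<le> m" "b = ws j" using ws by (metis atMost_iff imageE insertCI)
        ultimately show False using a(3) by (simp add: E_def)
      qed
      then show "\<forall>\<^sub>F v in nhds g. \<not> \<Theta> (interleave v w)"
        unfolding eventually_nhds using X(1,2) by (intro exI[of _ X]) simp
    qed
  qed
qed

section \<open>Closures of definable sets and formulas over them\<close>

lemma closure_of_box:
  fixes X :: "(nat \<Rightarrow> real) set"
  assumes X: "X \<subseteq> cart_power n" and y: "y \<in> cart_power n"
  shows "y \<in> powertop_real {..<n} closure_of X \<longleftrightarrow> (\<forall>\<delta>>0. \<exists>x\<in>X. \<forall>i<n. \<bar>x i - y i\<bar> < \<delta>)"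
proof
  assume cl: "y \<in> powertop_real {..<n} closure_of X"
  show "\<forall>\<delta>>0. \<exists>x\<in>X. \<forall>i<n. \<bar>x i - y i\<bar> < \<delta>"
  proof (intro allI impI)
    fix \<delta> :: real assume "\<delta> > 0"
    let ?T = "Pi\<^sub>E {..<n} (\<lambda>i. ball (y i) \<delta>)"
    have "openin (powertop_real {..<n}) ?T" by (simp add: openin_PiE)
    moreover have "y \<in> ?T" using y \<open>\<delta> > 0\<close> by (auto simp: PiE_iff)
    ultimately obtain x where x: "x \<in> X" "x \<in> ?T" using cl unfolding in_closure_of by blast
    have "\<bar>x i - y i\<bar> < \<delta>" if "i < n" for i
    proof -
      have "x i \<in> ball (y i) \<delta>" using PiE_mem[OF x(2), of i] that by simp
      then show ?thesis by (simp add: dist_real_def abs_minus_commute)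
    qed
    with x(1) show "\<exists>x\<in>X. \<forall>i<n. \<bar>x i - y i\<bar> < \<delta>" by blast
  qed
next
  assume near: "\<forall>\<delta>>0. \<exists>x\<in>X. \<forall>i<n. \<bar>x i - y i\<bar> < \<delta>"
  show "y \<in> powertop_real {..<n} closure_of X"
    unfolding in_closure_of
  proof (intro conjI allI impI)
    show "y \<in> topspace (powertop_real {..<n})" using y by simp
    fix T assume T: "y \<in> T \<and> openin (powertop_real {..<n}) T"
    then obtain U where U: "\<forall>i\<in>{..<n}. open (U i)" "y \<in> Pi\<^sub>E {..<n} U" "Pi\<^sub>E {..<n} U \<subseteq> T"
      unfolding openin_product_topology_alt by (auto simp flip: open_openin)
    have "\<forall>\<^sub>F \<delta> in at_right 0. \<forall>i\<in>{..<n}. ball (y i) \<delta> \<subseteq> U i"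
    proof (intro eventually_ball_finite ballI)
      fix i assume i: "i \<in> {..<n}"
      then obtain e where "e > 0" "ball (y i) e \<subseteq> U i"
        using U(1,2) PiE_mem[OF U(2) i] by (meson openE)
      then show "\<forall>\<^sub>F \<delta> in at_right 0. ball (y i) \<delta> \<subseteq> U i"
        unfolding eventually_at_right_field by (intro exI[of _ e]) auto
    qed simp
    then obtain \<delta> where \<delta>: "\<delta> > 0" "\<And>i. i < n \<Longrightarrow> ball (y i) \<delta> \<subseteq> U i"
      unfolding eventually_at_right_field by (metis dense lessThan_iff)
    obtain x where x: "x \<in> X" "\<And>i. i < n \<Longrightarrow> \<bar>x i - y i\<bar> < \<delta>" using near \<delta>(1) by blast
    have "x i \<in> U i" if "i < n" for i
      using \<delta>(2)[OF that] x(2)[OF that] by (auto simp: dist_real_def abs_minus_commute)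
    then have "x \<in> Pi\<^sub>E {..<n} U" using x(1) X by (auto simp: PiE_iff)
    with x(1) U(3) show "\<exists>x. x \<in> X \<and> x \<in> T" by blast
  qed
qed

lemma eventually_nhds_close:
  fixes f :: "nat \<Rightarrow> real" and n :: nat
  assumes "\<delta> > 0"
  shows "\<forall>\<^sub>F v in nhds f. \<forall>i<n. \<bar>v (\<rho> i) - f (\<rho> i)\<bar> < \<delta>"
proof -
  have "\<forall>\<^sub>F v in nhds f. \<bar>v (\<rho> i) - f (\<rho> i)\<bar> < \<delta>" for i
  proof (rule eventually_nhds_compose[where h = "\<lambda>v. v (\<rho> i)"])
    show "\<forall>\<^sub>F y in nhds (f (\<rho> i)). \<bar>y - f (\<rho> i)\<bar> < \<delta>"
      using assms by (auto simp: eventually_nhds_metric dist_real_def)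
  qed simp
  then have "\<forall>\<^sub>F v in nhds f. \<forall>i\<in>{..<n}. \<bar>v (\<rho> i) - f (\<rho> i)\<bar> < \<delta>"
    by (intro eventually_ball_finite) auto
  then show ?thesis by (simp add: Ball_def)
qed

lemma traceable_closure:
  fixes M :: "('f, 'r, real) fo_structure"
  assumes less: "definable_pred M (\<lambda>v. v 0 < v 1 + v 2)" and X: "definable M n X"
  shows "traceable M (\<lambda>v. restrict (v \<circ> \<rho>) {..<n} \<in> powertop_real {..<n} closure_of X)"
proof -
  have XC: "X \<subseteq> cart_power n" using X unfolding definable_def by auto
  have L: "definable_pred M (\<lambda>v. v i < v j + v k)" for i j k
    using definable_pred_reindex[OF less, of "\<lambda>l. if l = 0 then i else if l = 1 then j else k"] by simp
  \<comment> \<open>In \<open>interleave (interleave v w) x\<close> the indices denote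
    \<open>x i\<close>, \<open>v (\<rho> i)\<close> and \<open>w 0\<close>; their unevaluated form
    matches the rules for \<open>interleave\<close>. Closeness is split into two inequalities of the
    shape a < b + c, which is what \<open>less\<close> provides.\<close>
  define \<Psi> where "\<Psi> z \<longleftrightarrow> restrict (z \<circ> (\<lambda>i. Suc (2 * i))) {..<n} \<in> X \<and>
      (\<forall>i\<in>{..<n}. z (2 * (2 * \<rho> i)) < z (Suc (2 * i)) + z (2 * Suc (2 * 0))
        \<and> z (Suc (2 * i)) < z (2 * (2 * \<rho> i)) + z (2 * Suc (2 * 0)))" for z :: "nat \<Rightarrow> real"
  define \<Phi> where "\<Phi> u \<longleftrightarrow> (\<exists>x. \<Psi> (interleave u x))" for u
  have \<Phi>: "\<Phi> (interleave v w) \<longleftrightarrow> (\<exists>x\<in>X. \<forall>i<n. \<bar>x i - v (\<rho> i)\<bar> < w 0)" for v w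
  proof -
    have "\<Phi> (interleave v w) \<longleftrightarrow> (\<exists>x. restrict x {..<n} \<in> X \<and>
        (\<forall>i\<in>{..<n}. v (\<rho> i) < x i + w 0 \<and> x i < v (\<rho> i) + w 0))"
      unfolding \<Phi>_def \<Psi>_def by (simp only: interleave_comp_params interleave_even interleave_odd)
    also have "\<dots> \<longleftrightarrow> (\<exists>x. restrict x {..<n} \<in> X \<and> (\<forall>i<n. \<bar>x i - v (\<rho> i)\<bar> < w 0))"
      by (intro ex_cong1 conj_cong refl) (auto simp: abs_less_iff algebra_simps)
    also have "\<dots> \<longleftrightarrow> (\<exists>x\<in>X. \<forall>i<n. \<bar>x i - v (\<rho> i)\<bar> < w 0)"
    proof
      assume "\<exists>x. restrict x {..<n} \<in> X \<and> (\<forall>i<n. \<bar>x i - v (\<rho> i)\<bar> < w 0)"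
      then obtain x where "restrict x {..<n} \<in> X" "\<forall>i<n. \<bar>x i - v (\<rho> i)\<bar> < w 0" by blast
      then show "\<exists>x\<in>X. \<forall>i<n. \<bar>x i - v (\<rho> i)\<bar> < w 0" by (intro bexI[of _ "restrict x {..<n}"]) auto
    next
      assume "\<exists>x\<in>X. \<forall>i<n. \<bar>x i - v (\<rho> i)\<bar> < w 0"
      then obtain x where x: "x \<in> X" "\<forall>i<n. \<bar>x i - v (\<rho> i)\<bar> < w 0" by blast
      then have "restrict x {..<n} = x" using XC by (auto intro: PiE_restrict)
      then show "\<exists>x. restrict x {..<n} \<in> X \<and> (\<forall>i<n. \<bar>x i - v (\<rho> i)\<bar> < w 0)"
        using x by (intro exI[of _ x]) simp
    qed
    finally show ?thesis .
  qed
  have cl: "restrict (v \<circ> \<rho>) {..<n} \<in> powertop_real {..<n} closure_of X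
      \<longleftrightarrow> (\<forall>\<delta>>0. \<exists>x\<in>X. \<forall>i<n. \<bar>x i - v (\<rho> i)\<bar> < \<delta>)" for v
    by (subst closure_of_box[OF XC]) auto
  show ?thesis
  proof (rule traceableI[of M \<Phi>])
    show "definable_pred M \<Phi>"
      unfolding \<Phi>_def \<Psi>_def
      by (intro definable_pred_ex_valuation[of M \<Psi>, unfolded \<Psi>_def] definable_pred_conj L
          definable_pred_ball definable_pred_reindex[OF definable_pred_of_definable[OF X]]) simp
    fix F G
    assume FG: "finite F" "finite G"
      "\<And>f. f \<in> F \<Longrightarrow> restrict (f \<circ> \<rho>) {..<n} \<in> powertop_real {..<n} closure_of X"
      "\<And>g. g \<in> G \<Longrightarrow> restrict (g \<circ> \<rho>) {..<n} \<notin> powertop_real {..<n} closure_of X"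
    \<comment> \<open>Each of the finitely many g has a box around it that misses X. Half of the box
      is reserved for moving g, hence 2 * \<delta>.\<close>
    have "\<forall>\<^sub>F \<delta> in at_right 0. \<forall>g\<in>G. \<not> (\<exists>x\<in>X. \<forall>i<n. \<bar>x i - g (\<rho> i)\<bar> < 2 * \<delta>)"
    proof (intro eventually_ball_finite ballI FG(2))
      fix g assume "g \<in> G"
      then obtain d where d: "d > 0" "\<not> (\<exists>x\<in>X. \<forall>i<n. \<bar>x i - g (\<rho> i)\<bar> < d)"
        using FG(4) unfolding cl by blast
      then have "\<not> (\<exists>x\<in>X. \<forall>i<n. \<bar>x i - g (\<rho> i)\<bar> < 2 * \<delta>)" if "\<delta> < d / 2" for \<delta>
        using that by (smt (verit) field_sum_of_halves)
      then show "\<forall>\<^sub>F \<delta> in at_right 0. \<not> (\<exists>x\<in>X. \<forall>i<n. \<bar>x i - g (\<rho> i)\<bar> < 2 * \<delta>)"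
        unfolding eventually_at_right_field using d(1) by (intro exI[of _ "d / 2"]) simp
    qed
    then obtain \<delta> where \<delta>: "\<delta> > 0" "\<And>g. g \<in> G \<Longrightarrow> \<not> (\<exists>x\<in>X. \<forall>i<n. \<bar>x i - g (\<rho> i)\<bar> < 2 * \<delta>)"
      unfolding eventually_at_right_field by (metis dense)
    show "\<exists>w. (\<forall>f\<in>F. \<forall>\<^sub>F v in nhds f. \<Phi> (interleave v w)) \<and>
        (\<forall>g\<in>G. \<forall>\<^sub>F v in nhds g. \<not> \<Phi> (interleave v w))"
    proof (intro exI[of _ "\<lambda>_. \<delta>"] conjI ballI)
      fix f assume "f \<in> F"
      then obtain x where x: "x \<in> X" "\<forall>i<n. \<bar>x i - f (\<rho> i)\<bar> < \<delta> / 2"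
        using FG(3) \<delta>(1) unfolding cl by (meson half_gt_zero)
      have "\<forall>\<^sub>F v in nhds f. \<forall>i<n. \<bar>v (\<rho> i) - f (\<rho> i)\<bar> < \<delta> / 2"
        using \<delta>(1) by (intro eventually_nhds_close) simp
      then show "\<forall>\<^sub>F v in nhds f. \<Phi> (interleave v (\<lambda>_. \<delta>))"
        unfolding \<Phi>
      proof (rule eventually_mono)
        fix v assume v: "\<forall>i<n. \<bar>v (\<rho> i) - f (\<rho> i)\<bar> < \<delta> / 2"
        have "\<bar>x i - v (\<rho> i)\<bar> < \<delta>" if "i < n" for i
          using v[rule_format, OF that] x(2)[rule_format, OF that] by linarith
        with x(1) show "\<exists>x\<in>X. \<forall>i<n. \<bar>x i - v (\<rho> i)\<bar> < \<delta>" by blast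
      qed
    next
      fix g assume "g \<in> G"
      have "\<forall>\<^sub>F v in nhds g. \<forall>i<n. \<bar>v (\<rho> i) - g (\<rho> i)\<bar> < \<delta>"
        using \<delta>(1) by (rule eventually_nhds_close)
      then show "\<forall>\<^sub>F v in nhds g. \<not> \<Phi> (interleave v (\<lambda>_. \<delta>))"
        unfolding \<Phi>
      proof (rule eventually_mono, intro notI)
        fix v assume v: "\<forall>i<n. \<bar>v (\<rho> i) - g (\<rho> i)\<bar> < \<delta>" and "\<exists>x\<in>X. \<forall>i<n. \<bar>x i - v (\<rho> i)\<bar> < \<delta>"
        then obtain x where x: "x \<in> X" "\<forall>i<n. \<bar>x i - v (\<rho> i)\<bar> < \<delta>" by blast
        have "\<bar>x i - g (\<rho> i)\<bar> < 2 * \<delta>" if "i < n" for i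
          using v[rule_format, OF that] x(2)[rule_format, OF that] by linarith
        with x(1) \<delta>(2)[OF \<open>g \<in> G\<close>] show False by blast
      qed
    qed
  qed
qed

lemma traceable_open_core:
  fixes M :: "('f, 'r, real) fo_structure"
  assumes nip: "NIP M" and add: "definable_pred M (\<lambda>v. v 0 < v 1 + v 2)"
    and less: "definable_pred M (\<lambda>v. v 0 < v 1)" and "wf_formula (open_core M) p"
  shows "traceable M (\<lambda>v. sat (open_core M) v p)"
  using assms(4)
proof (induction p)
  case (Equal s t)
  have "\<exists>i. t = Var i" if "wf_term (open_core M) t" for t
    using that by (cases t) (auto simp: open_core_def)
  then obtain i j where ij: "s = Var i" "t = Var j" using Equal by (metis wf_formula.simps(1))
  \<comment> \<open>Equality belongs to the logic and not to the relation symbols, but the diagonal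
    is its own closure, so it is treated like a primitive.\<close>
  define X where "X = {x \<in> cart_power 2. x 0 = (x 1 :: real)}"
  define \<rho> where "\<rho> k = (if k = 0 then i else j)" for k :: nat
  have "definable M 2 X"
    unfolding definable_def X_def by (intro exI[of _ "Equal (Var 0) (Var 1)"]) auto
  then have tr: "traceable M (\<lambda>v. restrict (v \<circ> \<rho>) {..<2} \<in> powertop_real {..<2} closure_of X)"
    using add by (intro traceable_closure)
  have "restrict (v \<circ> \<rho>) {..<2} \<in> powertop_real {..<2} closure_of X \<longleftrightarrow> v i = v j" for v
  proof -
    have "restrict (v \<circ> \<rho>) {..<2} \<in> powertop_real {..<2} closure_of X \<longleftrightarrow>
        (\<forall>\<delta>>0. \<exists>x\<in>X. \<forall>k<2. \<bar>x k - restrict (v \<circ> \<rho>) {..<2} k\<bar> < \<delta>)"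
      by (rule closure_of_box) (auto simp: X_def)
    also have "\<dots> \<longleftrightarrow> v i = v j"
    proof
      assume close: "\<forall>\<delta>>0. \<exists>x\<in>X. \<forall>k<2. \<bar>x k - restrict (v \<circ> \<rho>) {..<2} k\<bar> < \<delta>"
      show "v i = v j"
      proof (rule ccontr)
        assume "v i \<noteq> v j"
        then obtain x where "x \<in> X" "\<forall>k<2. \<bar>x k - restrict (v \<circ> \<rho>) {..<2} k\<bar> < \<bar>v i - v j\<bar> / 2"
          using close[rule_format, of "\<bar>v i - v j\<bar> / 2"] by auto
        then have "x \<in> X" "\<bar>x 0 - restrict (v \<circ> \<rho>) {..<2} 0\<bar> < \<bar>v i - v j\<bar> / 2"
            "\<bar>x 1 - restrict (v \<circ> \<rho>) {..<2} 1\<bar> < \<bar>v i - v j\<bar> / 2"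
          by auto
        then have "x 0 = x 1" "\<bar>x 0 - v i\<bar> < \<bar>v i - v j\<bar> / 2" "\<bar>x 1 - v j\<bar> < \<bar>v i - v j\<bar> / 2"
          by (auto simp: X_def \<rho>_def)
        moreover from this(1) have "\<bar>v i - v j\<bar> \<le> \<bar>x 0 - v i\<bar> + \<bar>x 1 - v j\<bar>" by arith
        ultimately show False by (simp add: field_simps)
      qed
    next
      assume "v i = v j"
      then have "restrict (v \<circ> \<rho>) {..<2} \<in> X" by (auto simp: X_def \<rho>_def)
      then show "\<forall>\<delta>>0. \<exists>x\<in>X. \<forall>k<2. \<bar>x k - restrict (v \<circ> \<rho>) {..<2} k\<bar> < \<delta>"
        by (intro allI impI bexI[of _ "restrict (v \<circ> \<rho>) {..<2}"]) simp_all
    qed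
    finally show ?thesis .
  qed
  with tr show ?case by (simp add: ij)
next
  case (Rel r ts)
  obtain n C where r: "r = (n, C)" by force
  with Rel obtain X where X: "definable M n X" "C = powertop_real {..<n} closure_of X"
    and ts: "length ts = n" "\<forall>t\<in>set ts. wf_term (open_core M) t"
    by (auto simp: open_core_def)
  have "\<exists>i. t = Var i" if "wf_term (open_core M) t" for t
    using that by (cases t) (auto simp: open_core_def)
  then have "\<forall>k<n. \<exists>i. ts ! k = Var i" using ts by (metis nth_mem)
  then obtain \<rho> where \<rho>: "\<And>k. k < n \<Longrightarrow> ts ! k = Var (\<rho> k)" by metis
  have "restrict (\<lambda>i. map (eval_term (open_core M) v) ts ! i) {..<n} = restrict (v \<circ> \<rho>) {..<n}" for v
    using ts(1) \<rho> by (auto simp: fun_eq_iff restrict_def)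
  then have "sat (open_core M) v (Rel r ts) \<longleftrightarrow> restrict (v \<circ> \<rho>) {..<n} \<in> powertop_real {..<n} closure_of X" for v
    using r X(2) by (simp add: open_core_def)
  then show ?case using traceable_closure[OF add X(1), of \<rho>] by simp
next
  case (Neg p)
  then show ?case by (simp add: traceable_neg)
next
  case (Conj p q)
  then show ?case by (simp add: traceable_conj)
next
  case (Exists i p)
  then show ?case using traceable_ex[OF nip less] by simp
qed

section \<open>Noise yields the independence property\<close>

text \<open>The sets \<open>B i\<close> are shrunk once for each S: choose a point of
  \<open>B i \<inter> Y\<close> on the side of P prescribed by i \<in> S, separate these n points by
  one parameter, and pass to neighbourhoods on which its verdict is constant. Shrinking preserves
  earlier verdicts, and every \<open>B i\<close> still meets Y, so the noise can be used again for
  the next S.\<close>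

lemma traceable_not_noisy:
  fixes M :: "('f, 'r, real) fo_structure" and g :: "real \<Rightarrow> nat \<Rightarrow> real"
  assumes nip: "NIP M" and P: "traceable M P" and g: "continuous_on UNIV g"
    and J: "open J" "J \<inter> Y \<noteq> {}"
    and noisy: "\<And>B. open B \<Longrightarrow> B \<subseteq> J \<Longrightarrow> B \<inter> Y \<noteq> {} \<Longrightarrow>
      (\<exists>y\<in>B \<inter> Y. P (g y)) \<and> (\<exists>y\<in>B \<inter> Y. \<not> P (g y))"
  shows False
proof -
  obtain \<Phi> where def: "definable_pred M \<Phi>" and
    tr: "\<And>F G. finite F \<Longrightarrow> finite G \<Longrightarrow> (\<And>f. f \<in> F \<Longrightarrow> P f) \<Longrightarrow> (\<And>g. g \<in> G \<Longrightarrow> \<not> P g) \<Longrightarrow>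
      \<exists>w. (\<forall>f\<in>F. \<forall>\<^sub>F v in nhds f. \<Phi> (interleave v w)) \<and>
          (\<forall>g\<in>G. \<forall>\<^sub>F v in nhds g. \<not> \<Phi> (interleave v w))"
    using traceableE[OF P] by blast
  obtain n where n: "\<not> shatters (\<lambda>v w. \<Phi> (interleave v w)) n"
    using NIP_definable_pred[OF nip def] by blast
  have "\<exists>B w. \<forall>i<n. open (B i) \<and> B i \<subseteq> J \<and> B i \<inter> Y \<noteq> {} \<and>
      (\<forall>S\<in>\<S>. \<forall>x\<in>B i. \<Phi> (interleave (g x) (w S)) \<longleftrightarrow> i \<in> S)" if "finite \<S>" for \<S> :: "nat set set"
    using that
  proof (induction \<S> rule: finite_induct)
    case empty
    show ?case using J by (intro exI[of _ "\<lambda>_. J"]) auto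
  next
    case (insert S \<S>)
    then obtain B w where Bw: "\<And>i. i < n \<Longrightarrow> open (B i) \<and> B i \<subseteq> J \<and> B i \<inter> Y \<noteq> {} \<and>
      (\<forall>S\<in>\<S>. \<forall>x\<in>B i. \<Phi> (interleave (g x) (w S)) \<longleftrightarrow> i \<in> S)" by blast
    have "\<exists>y\<in>B i \<inter> Y. P (g y) \<longleftrightarrow> i \<in> S" if "i < n" for i
      using noisy[of "B i"] Bw[OF that] by (cases "i \<in> S") auto
    then obtain y where y: "\<And>i. i < n \<Longrightarrow> y i \<in> B i \<inter> Y" "\<And>i. i < n \<Longrightarrow> P (g (y i)) \<longleftrightarrow> i \<in> S"
      by metis
    have "\<exists>w. (\<forall>f\<in>(\<lambda>i. g (y i)) ` ({..<n} \<inter> S). \<forall>\<^sub>F v in nhds f. \<Phi> (interleave v w)) \<and>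
        (\<forall>f\<in>(\<lambda>i. g (y i)) ` ({..<n} - S). \<forall>\<^sub>F v in nhds f. \<not> \<Phi> (interleave v w))"
      by (rule tr) (use y in auto)
    then obtain w' where w': "\<And>i. i < n \<Longrightarrow> i \<in> S \<Longrightarrow> \<forall>\<^sub>F v in nhds (g (y i)). \<Phi> (interleave v w')"
      "\<And>i. i < n \<Longrightarrow> i \<notin> S \<Longrightarrow> \<forall>\<^sub>F v in nhds (g (y i)). \<not> \<Phi> (interleave v w')"
      by auto
    have "\<forall>\<^sub>F v in nhds (g (y i)). \<Phi> (interleave v w') \<longleftrightarrow> i \<in> S" if "i < n" for i
      using w'[OF that] by (cases "i \<in> S") auto
    then have "\<forall>\<^sub>F x in nhds (y i). \<Phi> (interleave (g x) w') \<longleftrightarrow> i \<in> S" if "i < n" for i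
      using g that by (intro eventually_nhds_compose[where h = g]) auto
    then have "\<forall>i. \<exists>A. i < n \<longrightarrow> open A \<and> y i \<in> A \<and> (\<forall>x\<in>A. \<Phi> (interleave (g x) w') \<longleftrightarrow> i \<in> S)"
      unfolding eventually_nhds by blast
    then obtain A where A: "\<And>i. i < n \<Longrightarrow> open (A i) \<and> y i \<in> A i \<and> (\<forall>x\<in>A i. \<Phi> (interleave (g x) w') \<longleftrightarrow> i \<in> S)"
      by metis
    show ?case
    proof (intro exI[of _ "\<lambda>i. B i \<inter> A i"] exI[of _ "w(S := w')"] allI impI)
      fix i assume i: "i < n"
      have "y i \<in> B i \<inter> A i \<inter> Y" using y(1)[OF i] A[OF i] by blast
      then show "open (B i \<inter> A i) \<and> B i \<inter> A i \<subseteq> J \<and> B i \<inter> A i \<inter> Y \<noteq> {} \<and>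
          (\<forall>T\<in>insert S \<S>. \<forall>x\<in>B i \<inter> A i. \<Phi> (interleave (g x) ((w(S := w')) T)) \<longleftrightarrow> i \<in> T)"
        using Bw[OF i] A[OF i] insert(2) by (auto simp: open_Int)
    qed
  qed
  from this[OF finite_Pow_iff[THEN iffD2, OF finite_lessThan[of n]]] obtain B w where Bw: "\<forall>i<n. open (B i) \<and> B i \<subseteq> J \<and> B i \<inter> Y \<noteq> {} \<and>
      (\<forall>S\<in>Pow {..<n}. \<forall>x\<in>B i. \<Phi> (interleave (g x) (w S)) \<longleftrightarrow> i \<in> S)"
    by (elim exE) simp_all
  then have "\<forall>i. \<exists>x. i < n \<longrightarrow> x \<in> B i" by (meson IntD1 ex_in_conv)
  then obtain x where "\<And>i. i < n \<Longrightarrow> x i \<in> B i" by metis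
  then have "shatters (\<lambda>v w. \<Phi> (interleave v w)) n"
    unfolding shatters_def using Bw by (intro exI[of _ "\<lambda>i. g (x i)"] exI[of _ w]) simp
  with n show False by simp
qed

section \<open>The open core\<close>

lemma definable_pred_add_of_expansion:
  assumes "expansion_of R real_ordered_group"
  shows "definable_pred R (\<lambda>v. v 0 < v 1 + v 2)"
proof -
  let ?X = "{x \<in> cart_power 3. x 0 < x 1 + x 2} :: (nat \<Rightarrow> real) set"
  have "definable real_ordered_group 3 ?X"
    unfolding definable_def
    by (intro exI[of _ "Rel () [Var 0, App () [Var 1, Var 2]]"]) (auto simp: real_ordered_group_def)
  then have "definable R 3 ?X" using assms by (simp add: expansion_of_def)
  from definable_pred_of_definable[OF this] show ?thesis by simp
qed

lemma definable_less_of_expansion: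
  assumes "expansion_of R real_ordered_group"
  shows "definable R 2 {x \<in> cart_power 2. x 0 < x 1}"
proof -
  have "definable real_ordered_group 2 {x \<in> cart_power 2. x 0 < x 1}"
    unfolding definable_def
    by (intro exI[of _ "Rel () [Var 0, Var 1]"]) (auto simp: real_ordered_group_def)
  then show ?thesis using assms by (simp add: expansion_of_def)
qed

lemma definable_pred_less_open_core:
  assumes "definable R 2 {x \<in> cart_power 2. x 0 < x 1}"
  shows "definable_pred (open_core R) (\<lambda>v. v 0 < v 1)"
proof -
  let ?C = "{x \<in> cart_power 2. x 0 \<le> x 1} :: (nat \<Rightarrow> real) set"
  let ?p = "Conj (Rel (2, ?C) [Var 0, Var 1]) (Neg (Equal (Var 0) (Var 1)))"
  have "(2, ?C) \<in> rsyms (open_core R)"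
    using assms closure_strict_order by (auto simp: open_core_def)
  then have "definable_pred (open_core R) (\<lambda>v. sat (open_core R) v ?p)"
    by (intro definable_pred_sat) (auto simp: open_core_def)
  moreover have "sat (open_core R) v ?p \<longleftrightarrow> v 0 < v 1" for v
    by (auto simp: open_core_def)
  ultimately show ?thesis by simp
qed

lemma definable_line_interval: "definable_line real_order {l<..<u}"
proof -
  have less: "definable_pred real_order (\<lambda>v. v 0 < v 1)"
    using definable_pred_sat[of real_order "Rel () [Var 0, Var 1]"] by (simp add: real_order_def)
  have "definable_pred real_order (\<lambda>v. v 1 < v 0 \<and> v 0 < v 2)"
    by (intro definable_pred_conj definable_pred_less[OF less])
  \<comment> \<open>Variables 1 and 2 become constants: the odd places 1 and 3 hold l and u.\<close>
  from definable_line_of_definable_pred[OF definable_pred_subst[OF this,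
      of "\<lambda>i. if i = 0 then l else u" "\<lambda>i. if i = 0 then 0 else if i = 1 then 1 else 3"]]
  show ?thesis by (simp add: interleave_def greaterThanLessThan_eq Int_def)
qed

lemma definable_line_singleton: "definable_line real_order {a}"
proof -
  have "definable_pred real_order (\<lambda>v. v 0 = v 1)"
    using definable_pred_sat[of real_order "Equal (Var 0) (Var 1)"] by simp
  from definable_line_of_definable_pred[OF definable_pred_subst[OF this, of "\<lambda>_. a" id]]
  show ?thesis by (simp add: interleave_def)
qed

text \<open>The parameters of \<Phi> become constant coordinates of a continuous embedding of the
  line into valuations, so only formulas without parameters have to be traceable.\<close>

lemma open_core_not_noisy:
  fixes R :: "('f, 'r, real) fo_structure"
  assumes "expansion_of R real_ordered_group" "NIP R"
    and \<Phi>: "definable_pred (open_core R) \<Phi>"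
    and J: "open J" "J \<inter> Y \<noteq> {}"
    and noisy: "\<And>B. open B \<Longrightarrow> B \<subseteq> J \<Longrightarrow> B \<inter> Y \<noteq> {} \<Longrightarrow>
      (\<exists>y\<in>B \<inter> Y. \<Phi> (\<lambda>_. y)) \<and> (\<exists>y\<in>B \<inter> Y. \<not> \<Phi> (\<lambda>_. y))"
  shows False
proof -
  obtain p c where p: "wf_formula (open_core R) p" "\<And>v. \<Phi> v \<longleftrightarrow> sat (open_core R) (interleave v c) p"
    using \<Phi> unfolding definable_pred_def by blast
  have "definable_pred R (\<lambda>v. v 0 < v 1)"
    using definable_pred_of_definable[OF definable_less_of_expansion[OF assms(1)]] by simp
  then have tr: "traceable R (\<lambda>v. sat (open_core R) v p)"
    by (intro traceable_open_core assms(2) definable_pred_add_of_expansion[OF assms(1)] p(1))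
  have "continuous_on UNIV (\<lambda>y :: real. interleave (\<lambda>_. y) c)"
  proof (rule continuous_on_coordinatewise_then_product)
    fix i show "continuous_on UNIV (\<lambda>y :: real. interleave (\<lambda>_. y) c i)"
      by (cases "even i") (simp_all add: interleave_def)
  qed
  from traceable_not_noisy[OF assms(2) tr this J] noisy show False
    unfolding p(2) by blast
qed

section \<open>Generic local o-minimality of the open core\<close>

theorem theoremC:
  fixes R :: "('f, 'r, real) fo_structure"
  assumes "expansion_of R real_ordered_group"
    and "NIP R"
  shows "generically_locally_o_minimal (open_core R)"
  unfolding generically_locally_o_minimal_def
proof (intro allI impI)
  fix X assume X: "definable_line (open_core R) X"
  note mem = definable_pred_of_definable_line[OF X]
  note less = definable_pred_less[OF definable_pred_less_open_core[OF definable_less_of_expansion[OF assms(1)]]]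
  \<comment> \<open>Either X fills an interval around a, or a is isolated in X. Being a condition in
    < and X only, it makes V definable in the open core.\<close>
  define nice where "nice a l u \<longleftrightarrow> l < a \<and> a < u \<and>
    ((\<forall>x. l < x \<and> x < u \<longrightarrow> x \<in> X) \<or> (\<forall>x. l < x \<and> x < u \<and> x \<in> X \<longrightarrow> \<not> x < a \<and> \<not> a < x))" for a l u
  define V where "V = {a \<in> X. \<exists>l u. nice a l u}"
  have "definable_line (open_core R) V"
  proof -
    have 1: "definable_pred (open_core R) (\<lambda>v. \<forall>x. v 1 < x \<and> x < v 2 \<longrightarrow> x \<in> X)"
      using definable_pred_all[of _ "\<lambda>v. v 1 < v 3 \<and> v 3 < v 2 \<longrightarrow> v 3 \<in> X" 3,
          OF definable_pred_imp[OF definable_pred_conj[OF less less] mem]] by simp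
    have 2: "definable_pred (open_core R)
        (\<lambda>v. \<forall>x. v 1 < x \<and> x < v 2 \<and> x \<in> X \<longrightarrow> \<not> x < v 0 \<and> \<not> v 0 < x)"
      using definable_pred_all[of _ "\<lambda>v. v 1 < v 3 \<and> v 3 < v 2 \<and> v 3 \<in> X \<longrightarrow> \<not> v 3 < v 0 \<and> \<not> v 0 < v 3" 3,
          OF definable_pred_imp[OF definable_pred_conj[OF less definable_pred_conj[OF less mem]]
            definable_pred_conj[OF definable_pred_neg[OF less] definable_pred_neg[OF less]]]] by simp
    have "definable_pred (open_core R) (\<lambda>v. nice (v 0) (v 1) (v 2))"
      unfolding nice_def by (intro definable_pred_conj definable_pred_disj less 1 2)
    from definable_pred_ex[OF this, of 2]
    have "definable_pred (open_core R) (\<lambda>v. \<exists>u. nice (v 0) (v 1) u)" by simp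
    from definable_pred_ex[OF this, of 1]
    have "definable_pred (open_core R) (\<lambda>v. \<exists>l u. nice (v 0) l u)" by simp
    from definable_line_of_definable_pred[OF definable_pred_conj[OF mem[of 0] this]]
    show ?thesis by (simp add: V_def)
  qed
  moreover have "openin (top_of_set X) V"
  proof -
    have "\<exists>T. open T \<and> a \<in> T \<and> X \<inter> T \<subseteq> V" if a: "a \<in> V" for a
    proof -
      obtain l u where lu: "nice a l u" using a by (auto simp: V_def)
      have "x \<in> V" if "x \<in> X" "x \<in> {l<..<u}" for x
      proof -
        have "nice x l u \<or> x = a"
          using lu that unfolding nice_def greaterThanLessThan_iff by (elim conjE disjE) auto
        then show ?thesis using \<open>a \<in> V\<close> \<open>x \<in> X\<close> by (auto simp: V_def)
      qed
      moreover have "a \<in> {l<..<u}" using lu by (simp add: nice_def)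
      ultimately show ?thesis by (intro exI[of _ "{l<..<u}"]) auto
    qed
    then obtain T where T: "\<And>a. a \<in> V \<Longrightarrow> open (T a) \<and> a \<in> T a \<and> X \<inter> T a \<subseteq> V" by metis
    have "V \<subseteq> X" by (auto simp: V_def)
    with T have "V = X \<inter> (\<Union>a\<in>V. T a)" by blast
    moreover have "open (\<Union>a\<in>V. T a)" using T by auto
    ultimately show ?thesis unfolding openin_open by (intro exI[of _ "\<Union>a\<in>V. T a"] conjI)
  qed
  moreover have "X \<subseteq> closure V"
  proof (rule ccontr)
    assume "\<not> X \<subseteq> closure V"
    then obtain a where a: "a \<in> X" "a \<notin> closure V" by blast
    define J where "J = - closure V"
    have "open J" by (simp add: J_def open_Compl)
    have "a \<in> J" using a by (simp add: J_def)
    have noint: "\<exists>x. l < x \<and> x < u \<and> x \<notin> X" "\<exists>x. l < x \<and> x < u \<and> x \<in> X \<and> x \<noteq> y"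
      if "y \<in> X" "y \<in> J" "l < y" "y < u" for y l u
    proof -
      have "y \<notin> V" using that(2) closure_subset[of V] by (auto simp: J_def)
      with that(1) have "\<not> nice y l u" by (auto simp: V_def)
      then show "\<exists>x. l < x \<and> x < u \<and> x \<notin> X" "\<exists>x. l < x \<and> x < u \<and> x \<in> X \<and> x \<noteq> y"
        using that unfolding nice_def by (blast, blast dest: less_imp_neq)
    qed
    show False
    proof (cases "\<exists>J'. open J' \<and> J' \<noteq> {} \<and> J' \<subseteq> J \<inter> closure X")
      case True
      then obtain J' where J': "open J'" "J' \<noteq> {}" "J' \<subseteq> J \<inter> closure X" by blast
      show False
      proof (rule open_core_not_noisy[OF assms mem[of 0] J'(1), of UNIV])
        show "J' \<inter> UNIV \<noteq> {}" using J'(2) by simp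
        fix B assume B: "open B" "B \<subseteq> J'" "B \<inter> UNIV \<noteq> {}"
        then have "B \<inter> closure X \<noteq> {}" using J'(3) by blast
        then obtain y where y: "y \<in> B" "y \<in> X" using open_Int_closure_eq_empty[OF B(1), of X] by blast
        obtain e where e: "e > 0" "ball y e \<subseteq> B" using B(1) y(1) by (rule openE)
        have "y \<in> J" using y(1) B(2) J'(3) by blast
        then obtain x where "y - e < x" "x < y + e" "x \<notin> X"
          using noint(1)[of y "y - e" "y + e"] y(2) e(1) by auto
        then have "x \<in> B" "x \<notin> X" using e(2) by (auto simp: ball_def dist_real_def subset_iff abs_less_iff)
        with y show "(\<exists>y\<in>B \<inter> UNIV. y \<in> X) \<and> (\<exists>y\<in>B \<inter> UNIV. y \<notin> X)" by blast
      qed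
    next
      case False
      \<comment> \<open>Now \<open>closure X\<close> has no interior in J, so between any two points
        of X close together in J there is a gap. D marks its left end.\<close>
      define D where "D d \<longleftrightarrow> (\<exists>\<eta>. d < \<eta> \<and> (\<forall>x. d < x \<and> x < \<eta> \<longrightarrow> x \<notin> X))" for d
      have "definable_pred (open_core R) (\<lambda>v. \<forall>x. v 0 < x \<and> x < v 1 \<longrightarrow> x \<notin> X)"
        using definable_pred_all[of _ "\<lambda>v. v 0 < v 2 \<and> v 2 < v 1 \<longrightarrow> v 2 \<notin> X" 2,
            OF definable_pred_imp[OF definable_pred_conj[OF less less] definable_pred_neg[OF mem]]]
        by simp
      from definable_pred_ex[OF definable_pred_conj[OF less[of 0 1] this], of 1]
      have D: "definable_pred (open_core R) (\<lambda>v. D (v 0))" by (simp add: D_def)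
      show False
      \<comment> \<open>The noise lives on \<open>closure X\<close> and not on X, because the ends
        of a gap need not belong to X.\<close>
      proof (rule open_core_not_noisy[OF assms D \<open>open J\<close>, of "closure X"])
        show "J \<inter> closure X \<noteq> {}" using a(1) \<open>a \<in> J\<close> closure_subset[of X] by blast
        fix B assume B: "open B" "B \<subseteq> J" "B \<inter> closure X \<noteq> {}"
        then obtain y where y: "y \<in> B" "y \<in> X" using open_Int_closure_eq_empty[OF B(1), of X] by blast
        obtain e where e: "e > 0" "ball y e \<subseteq> B" using B(1) y(1) by (rule openE)
        obtain z where z: "y - e < z" "z < y + e" "z \<in> X" "z \<noteq> y"
          using noint(2)[of y "y - e" "y + e"] y B(2) e(1) by auto
        define p q where "p = min y z" and "q = max y z"
        have pq: "p < q" "p \<in> X" "q \<in> X" using y z by (auto simp: p_def q_def min_def max_def)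
        have "{p..q} \<subseteq> ball y e" using z e(1) by (auto simp: p_def q_def dist_real_def)
        then have pqB: "x \<in> B" if "p \<le> x" "x \<le> q" for x using e(2) that by (meson atLeastAtMost_iff subsetD)
        have cl: "x \<in> closure X" if "x \<in> X" for x using closure_subset that by (rule subsetD)
        have "{p<..<q} \<subseteq> J" using pqB B(2) by (auto intro: subsetD)
        moreover have "{p<..<q} \<noteq> {}" using pq(1) by simp
        moreover from False have "\<not> (open {p<..<q} \<and> {p<..<q} \<noteq> {} \<and> {p<..<q} \<subseteq> J \<inter> closure X)"
          by blast
        ultimately have "\<not> {p<..<q} \<subseteq> closure X" by (simp add: open_greaterThanLessThan)
        then obtain g where "g \<in> {p<..<q}" "g \<notin> closure X" by blast
        then have g: "p < g" "g < q" "g \<notin> closure X" by simp_all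
        \<comment> \<open>d1 and e1 are the ends of the gap of \<open>closure X\<close> around g.
          Both stay in B, since p and q do together with everything between them.\<close>
        have "compact ({p..g} \<inter> closure X)" "compact ({g..q} \<inter> closure X)"
          by (simp_all add: compact_Int_closed)
        moreover have "p \<in> {p..g} \<inter> closure X" "q \<in> {g..q} \<inter> closure X"
          using pq g by (simp_all add: cl)
        ultimately have "\<exists>d\<in>{p..g} \<inter> closure X. \<forall>x\<in>{p..g} \<inter> closure X. x \<le> d"
          "\<exists>e\<in>{g..q} \<inter> closure X. \<forall>x\<in>{g..q} \<inter> closure X. e \<le> x"
          by (intro compact_attains_sup compact_attains_inf; blast)+
        then obtain d1 e1 where
          d1: "d1 \<in> {p..g} \<inter> closure X" "\<And>x. x \<in> {p..g} \<inter> closure X \<Longrightarrow> x \<le> d1" and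
          e1: "e1 \<in> {g..q} \<inter> closure X" "\<And>x. x \<in> {g..q} \<inter> closure X \<Longrightarrow> e1 \<le> x"
          by blast
        have "d1 < g" "g < e1" using d1(1) e1(1) g(3) by (auto simp: less_le)
        have "D d1"
          unfolding D_def
        proof (intro exI[of _ g] conjI allI impI notI)
          fix x assume x: "d1 < x \<and> x < g" "x \<in> X"
          then have "x \<in> {p..g} \<inter> closure X" using d1(1) by (simp add: cl)
          from d1(2)[OF this] x(1) show False by simp
        qed fact
        \<comment> \<open>If e1 were also the left end of a gap, only e1 could be a point of X
          between g and \<eta>. Lying in \<open>closure X\<close>, it would then belong to X and be
          isolated, which \<open>noint\<close> forbids in J.\<close>
        moreover have "\<not> D e1"
        proof
          assume "D e1"
          then obtain \<eta> where \<eta>: "e1 < \<eta>" "\<And>x. e1 < x \<Longrightarrow> x < \<eta> \<Longrightarrow> x \<notin> X" unfolding D_def by blast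
          have only: "x = e1" if "x \<in> X" "g < x" "x < \<eta>" for x
          proof (rule ccontr)
            assume "x \<noteq> e1"
            then have "x < e1" using \<eta>(2) that by (meson linorder_neqE)
            then have "x \<in> {g..q} \<inter> closure X" using that e1(1) by (simp add: cl)
            from e1(2)[OF this] \<open>x < e1\<close> show False by simp
          qed
          have "e1 \<in> {g<..<\<eta>} \<inter> closure X" using e1(1) \<open>g < e1\<close> \<eta>(1) by simp
          then obtain x where "x \<in> {g<..<\<eta>}" "x \<in> X"
            using open_Int_closure_eq_empty[OF open_greaterThanLessThan, of g \<eta> X] by blast
          with only have "e1 \<in> X" by auto
          moreover have "e1 \<in> J" using e1(1) g(1) by (intro subsetD[OF B(2)] pqB) simp_all
          ultimately obtain x where "g < x" "x < \<eta>" "x \<in> X" "x \<noteq> e1"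
            using noint(2)[of e1 g \<eta>] \<open>g < e1\<close> \<eta>(1) by blast
          with only show False by blast
        qed
        moreover have "d1 \<in> B \<inter> closure X" "e1 \<in> B \<inter> closure X"
          using d1(1) e1(1) g pqB by simp_all
        ultimately show "(\<exists>y\<in>B \<inter> closure X. D y) \<and> (\<exists>y\<in>B \<inter> closure X. \<not> D y)" by blast
      qed
    qed
  qed
  moreover have "\<exists>I. open I \<and> is_interval I \<and> a \<in> I \<and> definable_line real_order (I \<inter> X)" if a: "a \<in> V" for a
  proof -
    obtain l u where lu: "nice a l u" using a by (auto simp: V_def)
    have "a \<in> X" using a by (simp add: V_def)
    have "{l<..<u} \<inter> X = {l<..<u} \<or> {l<..<u} \<inter> X = {a}"
      using lu \<open>a \<in> X\<close> unfolding nice_def by (auto simp: set_eq_iff)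
    then have "definable_line real_order ({l<..<u} \<inter> X)"
      using definable_line_interval[of l u] definable_line_singleton[of a] by (elim disjE) simp_all
    moreover have "a \<in> {l<..<u}" using lu by (simp add: nice_def)
    ultimately show ?thesis by (intro exI[of _ "{l<..<u}"]) (simp add: is_interval_oo)
  qed
  ultimately show "\<exists>V. V \<subseteq> X \<and> definable_line (open_core R) V \<and> openin (top_of_set X) V \<and> X \<subseteq> closure V \<and>
      (\<forall>a\<in>V. \<exists>I. open I \<and> is_interval I \<and> a \<in> I \<and> definable_line real_order (I \<inter> X))"
    by (intro exI[of _ V]) (auto simp: V_def)
qed

end
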